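(* Let $K$ be a field. Given a bounded increasing function $f:\mathbb N\setminus\{0\}\to\mathbb N$, there exist a polynomial ring $S$ in finitely many variables over $K$ and a monomial ideal $I\subset S$ such that $\operatorname{depth}S/I^k=f(k)$ for all $k\ge1$.
   Context: $\mathbb N=\{0,1,2,\ldots\}$. "Increasing" is meant in the weak sense (nondecreasing). Depth is with respect to the graded maximal ideal of $S$. *)

theory Defs
  imports
    "HOL-Algebra.Ideal_Product"
    "HOL-Algebra.QuotRing"
    "HOL-Algebra.Module"
    "HOL-Library.Poly_Mapping"
    "HOL-Library.Extended_Nat"
begin

text \<open>
  The polynomial ring in the \<open>n\<close> variables \<open>x\<^sub>0, \<dots>, x\<^bsub>n-1\<^esub>\<close> over the field \<open>'k\<close>, with a polynomial
  encoded as the finitely supported map from exponent vectors to coefficients.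
\<close>

definition mpoly_ring :: "nat \<Rightarrow> ((nat \<Rightarrow>\<^sub>0 nat) \<Rightarrow>\<^sub>0 'k::field) ring" where
  "mpoly_ring n =
     \<lparr>carrier = {p. \<forall>m \<in> Poly_Mapping.keys p. Poly_Mapping.keys m \<subseteq> {..<n}},
      monoid.mult = (*), one = 1, ring.zero = 0, add = (+)\<rparr>"

definition monomial :: "(nat \<Rightarrow>\<^sub>0 nat) \<Rightarrow> ((nat \<Rightarrow>\<^sub>0 nat) \<Rightarrow>\<^sub>0 'k::field)" where
  "monomial m = Poly_Mapping.single m 1"

definition monomial_ideal :: "nat \<Rightarrow> ((nat \<Rightarrow>\<^sub>0 nat) \<Rightarrow>\<^sub>0 'k::field) set \<Rightarrow> bool" where
  "monomial_ideal n I \<longleftrightarrow>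
     (\<exists>A \<subseteq> {m. Poly_Mapping.keys m \<subseteq> {..<n}}. I = Idl\<^bsub>mpoly_ring n\<^esub> (monomial ` A))"

definition graded_max_ideal :: "nat \<Rightarrow> ((nat \<Rightarrow>\<^sub>0 nat) \<Rightarrow>\<^sub>0 'k::field) set" where
  "graded_max_ideal n = Idl\<^bsub>mpoly_ring n\<^esub> ((\<lambda>i. monomial (Poly_Mapping.single i 1)) ` {..<n})"

definition quot_module :: "('a, 'b) ring_scheme \<Rightarrow> 'a set \<Rightarrow> ('a, 'a set) module" where
  "quot_module R J =
     \<lparr>carrier = carrier (R Quot J), monoid.mult = monoid.mult (R Quot J), one = one (R Quot J),
      ring.zero = ring.zero (R Quot J), add = add (R Quot J),
      smult = (\<lambda>a X. (J +>\<^bsub>R\<^esub> a) \<otimes>\<^bsub>R Quot J\<^esub> X)\<rparr>"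

text \<open>The submodule \<open>(x\<^sub>1, \<dots>, x\<^sub>r) M\<close> of \<open>M\<close>.\<close>

definition seq_smult :: "('a, 'c, 'd) module_scheme \<Rightarrow> 'a list \<Rightarrow> 'c set" where
  "seq_smult M xs =
     {(\<Oplus>\<^bsub>M\<^esub>j \<in> {..<length xs}. xs ! j \<odot>\<^bsub>M\<^esub> m j) | m. m \<in> {..<length xs} \<rightarrow> carrier M}"

text \<open>
  \<open>M\<close>-regular sequences: \<open>x\<^sub>i\<close> is a non-zerodivisor on \<open>M / (x\<^sub>1, \<dots>, x\<^bsub>i-1\<^esub>) M\<close> for all \<open>i\<close>, and
  \<open>(x\<^sub>1, \<dots>, x\<^sub>r) M \<noteq> M\<close>.
\<close>

definition regular_sequence ::
    "('a, 'b) ring_scheme \<Rightarrow> ('a, 'c, 'd) module_scheme \<Rightarrow> 'a list \<Rightarrow> bool" where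
  "regular_sequence R M xs \<longleftrightarrow>
     set xs \<subseteq> carrier R \<and>
     (\<forall>i < length xs. \<forall>y \<in> carrier M.
        xs ! i \<odot>\<^bsub>M\<^esub> y \<in> seq_smult M (take i xs) \<longrightarrow> y \<in> seq_smult M (take i xs)) \<and>
     seq_smult M xs \<noteq> carrier M"

text \<open>
  The depth of \<open>M\<close> with respect to the ideal \<open>J\<close>: the supremum of the lengths of the \<open>M\<close>-regular
  sequences in \<open>J\<close>, and \<open>\<infinity>\<close> if \<open>J M = M\<close> (in particular if \<open>M = 0\<close>). The union below is \<open>J M\<close>.
\<close>

definition depth :: "('a, 'b) ring_scheme \<Rightarrow> 'a set \<Rightarrow> ('a, 'c, 'd) module_scheme \<Rightarrow> enat" where
  "depth R J M =
     (if (\<Union>xs \<in> lists J. seq_smult M xs) = carrier M then \<infinity>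
      else (SUP xs \<in> {xs \<in> lists J. regular_sequence R M xs}. enat (length xs)))"

lemma cring_mpoly_ring: "cring (mpoly_ring n :: ((nat \<Rightarrow>\<^sub>0 nat) \<Rightarrow>\<^sub>0 'k::field) ring)"
proof -
  let ?S = "mpoly_ring n :: ((nat \<Rightarrow>\<^sub>0 nat) \<Rightarrow>\<^sub>0 'k) ring"
  have add: "p + q \<in> carrier ?S" if "p \<in> carrier ?S" "q \<in> carrier ?S" for p q
    using that Poly_Mapping.keys_add[of p q] by (fastforce simp: mpoly_ring_def)
  have uminus: "- p \<in> carrier ?S" if "p \<in> carrier ?S" for p
    using that by (simp add: mpoly_ring_def)
  have mult: "p * q \<in> carrier ?S" if pq: "p \<in> carrier ?S" "q \<in> carrier ?S" for p q
  proof -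
    have "Poly_Mapping.keys m \<subseteq> {..<n}" if m_in: "m \<in> Poly_Mapping.keys (p * q)" for m
    proof -
      obtain a b where m: "m = a + b" and ab: "a \<in> Poly_Mapping.keys p" "b \<in> Poly_Mapping.keys q"
        using keys_mult[of p q] m_in by blast
      have "Poly_Mapping.keys a \<subseteq> {..<n}" "Poly_Mapping.keys b \<subseteq> {..<n}"
        using ab pq by (auto simp: mpoly_ring_def)
      then show ?thesis
        using Poly_Mapping.keys_add[of a b] unfolding m by blast
    qed
    then show ?thesis by (simp add: mpoly_ring_def)
  qed
  have one: "1 \<in> carrier ?S" and zero: "0 \<in> carrier ?S"
    by (simp_all add: mpoly_ring_def)
  have ops: "monoid.mult ?S = (*)" "one ?S = 1" "ring.zero ?S = 0" "add ?S = (+)"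
    by (simp_all add: mpoly_ring_def)
  show ?thesis
  proof (rule cringI)
    show "abelian_group ?S"
      using add zero by (intro abelian_groupI) (auto simp: ops add_ac intro!: bexI[OF _ uminus])
    show "comm_monoid ?S"
      using mult one by (intro comm_monoidI) (auto simp: ops mult_ac)
  qed (auto simp: ops distrib_right)
qed

lemma module_quot_module:
  fixes R (structure)
  assumes "cring R" "ideal J R"
  shows "Module.module R (quot_module R J)"
proof -
  interpret cring R by fact
  interpret ideal J R by fact
  interpret Q: cring "R Quot J"
    by (rule quotient_is_cring) (rule assms(1))
  interpret h: ring_hom_ring R "R Quot J" "(+>) J"
    by (rule rcos_ring_hom_ring)
  let ?M = "quot_module R J"
  have simps: "carrier ?M = carrier (R Quot J)" "add ?M = add (R Quot J)"
    "ring.zero ?M = ring.zero (R Quot J)"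
    "\<And>a X. a \<odot>\<^bsub>?M\<^esub> X = (J +> a) \<otimes>\<^bsub>R Quot J\<^esub> X"
    by (simp_all add: quot_module_def)
  show ?thesis
  proof (rule moduleI)
    show "cring R" by fact
    show "abelian_group ?M"
      using Q.add.inv_closed Q.l_neg
      by (intro abelian_groupI) (auto simp: simps Q.a_ac intro!: bexI[OF _ Q.a_inv_closed])
  qed (auto simp: simps Q.l_distr Q.r_distr Q.m_assoc)
qed

end

theory Submission
  imports Defs
begin

text \<open>
  Let \<open>a v\<close> be the least \<open>k \<ge> 1\<close> with \<open>v < f k + 2\<close>. For \<open>m\<close> large, let \<open>I\<close> be generated by
  \<open>(x, y) (x\<^sup>m, y\<^sup>m)\<close> and \<open>z\<^sub>v (x, y)\<^bsup>2 m - a v\<^esup>\<close> for \<open>v \<ge> 2\<close>. The staircase of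
  \<open>((x, y) (x\<^sup>m, y\<^sup>m))\<^sup>k\<close> has gaps that shrink as \<open>k\<close> grows, and from \<open>k = a v\<close> on they are so small that
  the generators of \<open>I\<^sup>k\<close> involving \<open>z\<^sub>v\<close> are redundant. So the \<open>f k\<close> variables \<open>z\<^sub>v\<close> with
  \<open>a v \<le> k\<close> form a regular sequence on \<open>S / I\<^sup>k\<close>, while a monomial \<open>w \<notin> I\<^sup>k\<close> on the boundary of the
  staircase is multiplied into \<open>I\<^sup>k\<close> by all other variables. No regular sequence is longer:
  such a \<open>w\<close> yields a nonzero class of degree \<open>f k\<close> in the Koszul cohomology of the variables, whereas
  a regular sequence of length \<open>r\<close> in the ideal of the variables makes this cohomology vanish below degree \<open>r\<close>.
\<close>

section \<open>Koszul cochains and regular sequences\<close>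

text \<open>The polynomials in \<open>n\<close> variables form a subset of a type that is itself a
  commutative ring. Working with a closed subset \<open>C\<close> lets the Koszul argument use the
  arithmetic of the type.\<close>

locale carrier_ring =
  fixes C :: "'a::comm_ring_1 set"
  assumes zero_closed: "0 \<in> C" and one_closed: "1 \<in> C"
    and add_closed: "a \<in> C \<Longrightarrow> b \<in> C \<Longrightarrow> a + b \<in> C"
    and uminus_closed: "a \<in> C \<Longrightarrow> - a \<in> C"
    and mult_closed: "a \<in> C \<Longrightarrow> b \<in> C \<Longrightarrow> a * b \<in> C"
begin

lemma sum_closed: "(\<And>i. i \<in> A \<Longrightarrow> g i \<in> C) \<Longrightarrow> sum g A \<in> C"
  by (induction A rule: infinite_finite_induct) (auto intro: zero_closed add_closed)

end

section \<open>Koszul differential, contraction and homotopy\<close>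

definition koszul_sign :: "nat \<Rightarrow> nat set \<Rightarrow> 'a::comm_ring_1" where
  "koszul_sign v A = (- 1) ^ card {u \<in> A. u < v}"

text \<open>With \<open>c\<close> read as the exterior form whose coefficient at \<open>e_A\<close>
  is \<open>c A\<close>, this is left multiplication by the 1-form with coefficients
  \<open>X\<close>. One function holds all degrees; the degree is \<open>card A\<close>.\<close>

definition koszul_diff :: "(nat \<Rightarrow> 'a::comm_ring_1) \<Rightarrow> (nat set \<Rightarrow> 'a) \<Rightarrow> nat set \<Rightarrow> 'a" where
  "koszul_diff X c A = (\<Sum>v\<in>A. koszul_sign v A * X v * c (A - {v}))"

text \<open>Interior product with the functional whose value on the \<open>u\<close>-th basis vector
  is \<open>e u\<close>; the indices range over \<open>V\<close>.\<close>

definition koszul_contract ::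
    "nat set \<Rightarrow> (nat \<Rightarrow> 'a::comm_ring_1) \<Rightarrow> (nat set \<Rightarrow> 'a) \<Rightarrow> nat set \<Rightarrow> 'a" where
  "koszul_contract V e c A = (\<Sum>u\<in>V - A. koszul_sign u A * e u * c (insert u A))"

lemma koszul_sign_self [simp]:
  "koszul_sign v (insert v A) = (koszul_sign v A :: 'a::comm_ring_1)"
  "koszul_sign v (A - {v}) = (koszul_sign v A :: 'a::comm_ring_1)"
  by (simp_all add: koszul_sign_def) (metis (lifting) Diff_iff insertE nat_neq_iff)+

lemma koszul_sign_square [simp]: "koszul_sign v A * koszul_sign v A = (1::'a::comm_ring_1)"
  by (simp add: koszul_sign_def flip: power_add mult_2)

lemma koszul_sign_insert:
  assumes "finite A" "u \<notin> A"
  shows "koszul_sign v (insert u A) = (if u < v then - koszul_sign v A else koszul_sign v A :: 'a::comm_ring_1)"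
proof -
  have "{w \<in> insert u A. w < v} = (if u < v then insert u {w \<in> A. w < v} else {w \<in> A. w < v})"
    by auto
  then show ?thesis using assms by (simp add: koszul_sign_def)
qed

lemma koszul_sign_remove:
  assumes "finite A" "u \<in> A"
  shows "koszul_sign v (A - {u}) = (if u < v then - koszul_sign v A else koszul_sign v A :: 'a::comm_ring_1)"
  using koszul_sign_insert[of "A - {u}" u v, where ?'a = 'a] assms
  by (auto simp: insert_absorb split: if_splits)

text \<open>Removing and inserting the same index gives \<open>e v * X v * c A\<close>, from the
  first summand if \<open>v \<in> A\<close> and from the second otherwise. The terms with two
  distinct indices occur in both summands with opposite signs.\<close>

lemma koszul_homotopy:
  fixes X e :: "nat \<Rightarrow> 'a::comm_ring_1"
  assumes V: "finite V" and A: "A \<subseteq> V"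
  shows "koszul_diff X (koszul_contract V e c) A + koszul_contract V e (koszul_diff X c) A
    = (\<Sum>v\<in>V. e v * X v) * c A"
proof -
  have fin: "finite A" using V A by (rule finite_subset[rotated])
  let ?s = koszul_sign
  have 1: "?s v A * X v * koszul_contract V e c (A - {v})
     = e v * X v * c A + (\<Sum>u\<in>V - A. ?s v A * ?s u (A - {v}) * X v * e u * c (insert u (A - {v})))"
    if v: "v \<in> A" for v
  proof -
    have "V - (A - {v}) = insert v (V - A)" using v A by auto
    moreover have "?s v A * X v * (?s v A * (e v * c A)) = (?s v A * ?s v A) * (X v * e v * c A)"
      by (simp only: mult_ac)
    ultimately show ?thesis using v V
      by (simp add: koszul_contract_def sum_distrib_left distrib_left insert_absorb mult_ac)
  qed
  have 2: "?s u A * e u * koszul_diff X c (insert u A)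
     = e u * X u * c A + (\<Sum>v\<in>A. ?s u A * ?s v (insert u A) * X v * e u * c (insert u (A - {v})))"
    if u: "u \<in> V - A" for u
  proof -
    have "insert u A - {v} = insert u (A - {v})" if "v \<in> A" for v using u that by auto
    moreover have "?s u A * e u * (?s u A * (X u * c A)) = (?s u A * ?s u A) * (X u * e u * c A)"
      by (simp only: mult_ac)
    ultimately show ?thesis using u fin
      by (simp add: koszul_diff_def sum_distrib_left distrib_left mult_ac)
  qed
  \<comment> \<open>Exactly one of \<open>?s u (A - {v})\<close> and
    \<open>?s v (insert u A)\<close> differs from the corresponding sign over \<open>A\<close>,
    depending on which of \<open>u\<close> and \<open>v\<close> is smaller.\<close>
  have sign: "?s v A * ?s u (A - {v}) + ?s u A * ?s v (insert u A) = (0::'a)"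
    if "v \<in> A" "u \<in> V - A" for u v
    using that fin by (auto simp: koszul_sign_insert koszul_sign_remove)
  have "koszul_diff X (koszul_contract V e c) A + koszul_contract V e (koszul_diff X c) A =
     (\<Sum>v\<in>A. e v * X v * c A) + (\<Sum>u\<in>V - A. e u * X u * c A) +
     ((\<Sum>v\<in>A. \<Sum>u\<in>V - A. ?s v A * ?s u (A - {v}) * X v * e u * c (insert u (A - {v})))
     + (\<Sum>u\<in>V - A. \<Sum>v\<in>A. ?s u A * ?s v (insert u A) * X v * e u * c (insert u (A - {v}))))"
    unfolding koszul_diff_def[of X "koszul_contract V e c"]
      koszul_contract_def[of V e "koszul_diff X c"]
    by (simp add: 1 2 sum.distrib)
  also have "(\<Sum>u\<in>V - A. \<Sum>v\<in>A. ?s u A * ?s v (insert u A) * X v * e u * c (insert u (A - {v})))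
     = (\<Sum>v\<in>A. \<Sum>u\<in>V - A. ?s u A * ?s v (insert u A) * X v * e u * c (insert u (A - {v})))"
    by (rule sum.swap)
  also have "(\<Sum>v\<in>A. \<Sum>u\<in>V - A. ?s v A * ?s u (A - {v}) * X v * e u * c (insert u (A - {v}))) + \<dots>
     = (\<Sum>v\<in>A. \<Sum>u\<in>V - A. (?s v A * ?s u (A - {v}) + ?s u A * ?s v (insert u A)) * (X v * e u * c (insert u (A - {v}))))"
    unfolding sum.distrib[symmetric] distrib_right mult.assoc ..
  also have "\<dots> = 0"
    by (intro sum.neutral ballI) (simp add: sign)
  also have "(\<Sum>v\<in>A. e v * X v * c A) + (\<Sum>u\<in>V - A. e u * X u * c A) = (\<Sum>v\<in>V. e v * X v * c A)"
    by (simp add: sum.subset_diff[OF A V] add.commute)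
  finally show ?thesis by (simp add: sum_distrib_right)
qed

text \<open>Two indices can be removed in either order, and exchanging them flips exactly one sign,
  so the terms cancel in pairs.\<close>

lemma koszul_diff_diff:
  fixes X :: "nat \<Rightarrow> 'a::comm_ring_1"
  assumes fin: "finite A"
  shows "koszul_diff X (koszul_diff X c) A = 0"
proof -
  let ?s = koszul_sign
  let ?g = "\<lambda>v u. ?s v A * ?s u (A - {v}) * (X v * X u * c (A - {v, u}))"
  have A: "A - {v} - {u} = A - {v, u}" for u v by auto
  have anti: "?g v u = - ?g u v" if "v \<in> A" "u \<in> A" "u < v" for u v
    using that fin by (simp add: koszul_sign_remove insert_commute mult_ac)
  have "koszul_diff X (koszul_diff X c) A = (\<Sum>v\<in>A. \<Sum>u\<in>A - {v}. ?g v u)"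
    by (simp add: koszul_diff_def sum_distrib_left mult_ac A)
  also have "\<dots> = (\<Sum>v\<in>A. (\<Sum>u\<in>A. if u < v then ?g v u else 0) + (\<Sum>u\<in>A. if v < u then ?g v u else 0))"
  proof (intro sum.cong refl)
    fix v assume v: "v \<in> A"
    have "A - {v} = {u \<in> A. u < v} \<union> {u \<in> A. v < u}" by auto
    then have "(\<Sum>u\<in>A - {v}. ?g v u) = (\<Sum>u | u \<in> A \<and> u < v. ?g v u) + (\<Sum>u | u \<in> A \<and> v < u. ?g v u)"
      using fin by (simp add: sum.union_disjoint disjoint_iff)
    then show "(\<Sum>u\<in>A - {v}. ?g v u) =
        (\<Sum>u\<in>A. if u < v then ?g v u else 0) + (\<Sum>u\<in>A. if v < u then ?g v u else 0)"
      using fin by (simp add: sum.inter_filter)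
  qed
  also have "\<dots> = (\<Sum>v\<in>A. \<Sum>u\<in>A. if u < v then ?g v u else 0) + (\<Sum>v\<in>A. \<Sum>u\<in>A. if v < u then ?g v u else 0)"
    by (simp add: sum.distrib)
  also have "(\<Sum>v\<in>A. \<Sum>u\<in>A. if v < u then ?g v u else 0) = (\<Sum>u\<in>A. \<Sum>v\<in>A. if v < u then ?g v u else 0)"
    by (rule sum.swap)
  also have "(\<Sum>v\<in>A. \<Sum>u\<in>A. if u < v then ?g v u else 0) + \<dots> =
     (\<Sum>v\<in>A. \<Sum>u\<in>A. if u < v then ?g v u + ?g u v else 0)"
    by (simp add: sum.distrib[symmetric] if_distrib cong: if_cong)
  also have "\<dots> = 0"
    by (intro sum.neutral ballI) (simp add: anti)
  finally show ?thesis .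
qed

section \<open>Ideals and vanishing of Koszul cohomology\<close>

locale carrier_ideal = carrier_ring C for C :: "'a::comm_ring_1 set" +
  fixes J
  assumes ideal_subset: "J \<subseteq> C" and ideal_zero: "0 \<in> J"
    and ideal_add: "a \<in> J \<Longrightarrow> b \<in> J \<Longrightarrow> a + b \<in> J"
    and ideal_mult: "a \<in> C \<Longrightarrow> b \<in> J \<Longrightarrow> a * b \<in> J"
begin

lemma ideal_sum: "(\<And>i. i \<in> A \<Longrightarrow> g i \<in> J) \<Longrightarrow> sum g A \<in> J"
  by (induction A rule: infinite_finite_induct) (auto intro: ideal_zero ideal_add)

lemma ideal_uminus: "a \<in> J \<Longrightarrow> - a \<in> J"
  using ideal_mult[of "- 1" a] one_closed uminus_closed by auto

lemma koszul_sign_closed: "koszul_sign v A \<in> C"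
proof -
  have "(- 1) ^ i \<in> C" for i :: nat
    by (induction i) (auto intro: one_closed uminus_closed)
  then show ?thesis by (simp add: koszul_sign_def)
qed

lemma koszul_diff_in_ideal:
  assumes "\<And>v. v \<in> A \<Longrightarrow> X v \<in> C" "\<And>v. v \<in> A \<Longrightarrow> c (A - {v}) \<in> J"
  shows "koszul_diff X c A \<in> J"
  unfolding koszul_diff_def
  by (intro ideal_sum ideal_mult mult_closed koszul_sign_closed assms)

lemma koszul_contract_in_ideal:
  assumes "\<And>v. v \<in> V \<Longrightarrow> e v \<in> C" "\<And>v. v \<in> V \<Longrightarrow> c (insert v A) \<in> J"
  shows "koszul_contract V e c A \<in> J"
  unfolding koszul_contract_def
  by (intro ideal_sum ideal_mult mult_closed koszul_sign_closed assms) auto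

end

text \<open>The scalar \<open>a\<close> covers both plain sums, with \<open>a = 1\<close>, and
  multiples of an element of the regular sequence.\<close>

lemma koszul_diff_linear:
  "koszul_diff X (\<lambda>A. c A + a * c' A) A = koszul_diff X c A + a * koszul_diff X c' A"
  by (simp add: koszul_diff_def sum.distrib sum_distrib_left algebra_simps)

text \<open>With the whole carrier as an ideal, closure of \<open>C\<close> under differential and
  contraction is a case of the lemmas on ideals.\<close>

lemma (in carrier_ring) carrier_ideal_carrier: "carrier_ideal C C"
  by unfold_locales (auto intro: zero_closed add_closed mult_closed)

text \<open>
  Let \<open>d\<close> be the differential and \<open>h\<close> the contraction along the next element \<open>a\<close> of the sequence. By
  the homotopy formula a cocycle \<open>z\<close> satisfies \<open>a z = d h z\<close>, so \<open>h z\<close> is a cocycle modulo \<open>a\<close>. The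
  shorter sequence gives \<open>h z = d y + a q\<close>; hence \<open>a z = a d q\<close>, and \<open>a\<close> can be cancelled.
\<close>

lemma (in carrier_ring) koszul_exact:
  fixes X :: "nat \<Rightarrow> 'a"
  assumes V: "finite V" and X: "\<And>v. v \<in> V \<Longrightarrow> X v \<in> C"
    and J: "\<And>i. i \<le> r \<Longrightarrow> carrier_ideal C (J i)"
    and J_Suc: "\<And>i p. i < r \<Longrightarrow> p \<in> J (Suc i) \<Longrightarrow> \<exists>y\<in>C. p - a i * y \<in> J i"
    and J_mono: "\<And>i. i < r \<Longrightarrow> J i \<subseteq> J (Suc i)"
    and a_in: "\<And>i. i < r \<Longrightarrow> a i \<in> J (Suc i)"
    and a_gen: "\<And>i. i < r \<Longrightarrow> \<exists>e. (\<forall>v\<in>V. e v \<in> C) \<and> a i = (\<Sum>v\<in>V. e v * X v)"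
    and regular: "\<And>i y. i < r \<Longrightarrow> y \<in> C \<Longrightarrow> a i * y \<in> J i \<Longrightarrow> y \<in> J i"
    and "i \<le> r"
    and z: "\<And>A. A \<subseteq> V \<Longrightarrow> z A \<in> C" "\<And>A. A \<subseteq> V \<Longrightarrow> card A \<ge> r - i \<Longrightarrow> z A = 0"
    and dz: "\<And>A. A \<subseteq> V \<Longrightarrow> koszul_diff X z A \<in> J i"
  shows "\<exists>y. \<forall>A\<subseteq>V. y A \<in> C \<and> z A - koszul_diff X y A \<in> J i"
  using \<open>i \<le> r\<close> z dz
proof (induction i arbitrary: z rule: inc_induct)
  \<comment> \<open>At \<open>i = r\<close> the degree bound is \<open>0\<close>, so
    \<open>z\<close> vanishes on every subset of \<open>V\<close> and \<open>y = 0\<close>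
    works.\<close>
  case base
  interpret carrier_ideal C "J r" using J by simp
  show ?case
    using base by (intro exI[of _ "\<lambda>_. 0"]) (simp add: koszul_diff_def ideal_zero zero_closed)
next
  case (step i)
  interpret Ji: carrier_ideal C "J i" using J step.hyps by simp
  interpret JS: carrier_ideal C "J (Suc i)" using J step.hyps by simp
  interpret CC: carrier_ideal C C by (rule carrier_ideal_carrier)
  obtain e where e: "\<And>v. v \<in> V \<Longrightarrow> e v \<in> C" "a i = (\<Sum>v\<in>V. e v * X v)"
    using a_gen step.hyps by blast
  have a: "a i \<in> C" using a_in[of i] JS.ideal_subset step.hyps by auto
  let ?h = "koszul_contract V e z"
  have h: "?h A \<in> C" if "A \<subseteq> V" for A
    using that by (intro CC.koszul_contract_in_ideal e step.prems) auto
  \<comment> \<open>Contraction reads \<open>z\<close> on sets with one more element, so the degree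
    bound drops by one, as \<open>Suc i\<close> requires.\<close>
  have h0: "?h A = 0" if "A \<subseteq> V" "r - Suc i \<le> card A" for A
    unfolding koszul_contract_def
  proof (intro sum.neutral ballI)
    fix u assume u: "u \<in> V - A"
    have "finite A" using V that by (auto intro: finite_subset)
    then have "card (insert u A) \<ge> r - i" using u that by simp
    then have "z (insert u A) = 0" using u that by (intro step.prems) auto
    then show "koszul_sign u A * e u * z (insert u A) = 0" by simp
  qed
  have hom: "koszul_diff X ?h A = a i * z A - koszul_contract V e (koszul_diff X z) A" if "A \<subseteq> V" for A
    using koszul_homotopy[OF V that, of X e z] by (simp add: e algebra_simps)
  have hd: "koszul_contract V e (koszul_diff X z) A \<in> J i" if "A \<subseteq> V" for A
    using that by (intro Ji.koszul_contract_in_ideal e step.prems) auto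
  have "koszul_diff X ?h A \<in> J (Suc i)" if "A \<subseteq> V" for A
  proof -
    have "z A * a i + - koszul_contract V e (koszul_diff X z) A \<in> J (Suc i)"
      using that hd[of A] a_in[of i] J_mono[of i] step.hyps step.prems(1)[of A]
      by (intro JS.ideal_add JS.ideal_mult JS.ideal_uminus) auto
    then show ?thesis using hom[OF that] by (simp add: mult.commute)
  qed
  from step.IH[OF h h0 this] obtain y
    where y: "\<And>A. A \<subseteq> V \<Longrightarrow> y A \<in> C" "\<And>A. A \<subseteq> V \<Longrightarrow> ?h A - koszul_diff X y A \<in> J (Suc i)"
    by blast
  have "\<exists>q. q \<in> C \<and> ?h A - koszul_diff X y A - a i * q \<in> J i" if "A \<subseteq> V" for A
    using J_Suc[of i, OF _ y(2)[OF that]] step.hyps by auto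
  then obtain q where q: "\<And>A. A \<subseteq> V \<Longrightarrow> q A \<in> C"
      "\<And>A. A \<subseteq> V \<Longrightarrow> ?h A - koszul_diff X y A - a i * q A \<in> J i"
    by metis
  have "z A - koszul_diff X q A \<in> J i" if A: "A \<subseteq> V" for A
  proof (rule regular)
    have fin: "finite A" using A V by (rule finite_subset)
    let ?g = "\<lambda>A. ?h A - koszul_diff X y A - a i * q A"
    \<comment> \<open>\<open>?g\<close> is the error of the approximation of \<open>?h\<close> by a
      coboundary plus a multiple of \<open>a i\<close>; its values lie in \<open>J i\<close>. Under
      the differential the term in \<open>y\<close> disappears.\<close>
    have "koszul_diff X ?h A = koszul_diff X (\<lambda>A. (?g A + 1 * koszul_diff X y A) + a i * q A) A"
      by simp
    also have "\<dots> = koszul_diff X ?g A + a i * koszul_diff X q A"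
      unfolding koszul_diff_linear koszul_diff_diff[OF fin] by simp
    finally have "a i * (z A - koszul_diff X q A)
        = koszul_contract V e (koszul_diff X z) A + koszul_diff X ?g A"
      using hom[OF A] by (simp add: algebra_simps)
    moreover have "koszul_diff X ?g A \<in> J i"
      using A by (intro Ji.koszul_diff_in_ideal q X) auto
    ultimately show "a i * (z A - koszul_diff X q A) \<in> J i"
      using hd[OF A] by (simp add: Ji.ideal_add)
    have "koszul_diff X q A \<in> C"
      using A by (intro CC.koszul_diff_in_ideal q X) auto
    then show "z A - koszul_diff X q A \<in> C"
      using add_closed[OF _ uminus_closed] step.prems(1)[OF A] by fastforce
  qed (use step.hyps in auto)
  then show ?case using q by blast
qed

text \<open>The cochain with value \<open>w\<close> on \<open>Z\<close> and \<open>0\<close> elsewhere is a cocycle, but not a coboundary.\<close>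

lemma (in carrier_ring) regular_length_le_card:
  fixes X :: "nat \<Rightarrow> 'a"
  assumes V: "finite V" and X: "\<And>v. v \<in> V \<Longrightarrow> X v \<in> C"
    and J: "\<And>i. i \<le> r \<Longrightarrow> carrier_ideal C (J i)"
    and J_Suc: "\<And>i p. i < r \<Longrightarrow> p \<in> J (Suc i) \<Longrightarrow> \<exists>y\<in>C. p - a i * y \<in> J i"
    and J_mono: "\<And>i. i < r \<Longrightarrow> J i \<subseteq> J (Suc i)"
    and a_in: "\<And>i. i < r \<Longrightarrow> a i \<in> J (Suc i)"
    and a_gen: "\<And>i. i < r \<Longrightarrow> \<exists>e. (\<forall>v\<in>V. e v \<in> C) \<and> a i = (\<Sum>v\<in>V. e v * X v)"
    and regular: "\<And>i y. i < r \<Longrightarrow> y \<in> C \<Longrightarrow> a i * y \<in> J i \<Longrightarrow> y \<in> J i"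
    and Z: "Z \<subseteq> V" and w: "w \<in> C" "\<And>v. v \<in> V - Z \<Longrightarrow> X v * w \<in> J 0"
    and not_in: "\<And>c. (\<And>v. v \<in> Z \<Longrightarrow> c v \<in> C) \<Longrightarrow> w - (\<Sum>v\<in>Z. c v * X v) \<notin> J 0"
  shows "r \<le> card Z"
proof (rule ccontr)
  assume "\<not> r \<le> card Z"
  then have r: "card Z < r" by simp
  interpret J0: carrier_ideal C "J 0" using J by simp
  define z where "z A = (if A = Z then w else 0)" for A
  have dz: "koszul_diff X z A \<in> J 0" if A: "A \<subseteq> V" for A
    unfolding koszul_diff_def
  proof (rule J0.ideal_sum)
    fix v assume v: "v \<in> A"
    show "koszul_sign v A * X v * z (A - {v}) \<in> J 0"
    proof (cases "A - {v} = Z")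
      case True
      \<comment> \<open>Here \<open>v \<notin> Z\<close>, since \<open>Z\<close> is \<open>A\<close>
        without \<open>v\<close>.\<close>
      then have "X v * w \<in> J 0" using v A by (intro w) auto
      then show ?thesis
        using True J0.koszul_sign_closed by (simp add: z_def mult.assoc J0.ideal_mult)
    qed (simp add: z_def J0.ideal_zero)
  qed
  \<comment> \<open>\<open>z\<close> lives in degree \<open>card Z < r\<close>, the range in which
    cocycles are coboundaries.\<close>
  have z: "z A \<in> C" "card A \<ge> r - 0 \<Longrightarrow> z A = 0" if "A \<subseteq> V" for A
    using r w(1) zero_closed by (auto simp: z_def)
  have "\<exists>y. \<forall>A\<subseteq>V. y A \<in> C \<and> z A - koszul_diff X y A \<in> J 0"
    by (rule koszul_exact[of V X r J a 0 z])
      (fact V X J J_Suc J_mono a_in a_gen regular z dz le0)+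
  then obtain y where y: "\<And>A. A \<subseteq> V \<Longrightarrow> y A \<in> C" "\<And>A. A \<subseteq> V \<Longrightarrow> z A - koszul_diff X y A \<in> J 0"
    by blast
  \<comment> \<open>The value of a coboundary at \<open>Z\<close> is a combination of the
    \<open>X v\<close> with \<open>v \<in> Z\<close>, and \<open>not_in\<close> keeps
    \<open>w\<close> away from these.\<close>
  have "w - (\<Sum>v\<in>Z. (koszul_sign v Z * y (Z - {v})) * X v) \<in> J 0"
    using y(2)[OF Z] by (simp add: z_def koszul_diff_def mult_ac)
  then show False
    using not_in[of "\<lambda>v. koszul_sign v Z * y (Z - {v})"] Z
    by (auto intro!: mult_closed J0.koszul_sign_closed y)
qed

section \<open>Monomial ideals\<close>

abbreviation exps :: "nat \<Rightarrow> (nat \<Rightarrow>\<^sub>0 nat) set" where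
  "exps n \<equiv> {m. Poly_Mapping.keys m \<subseteq> {..<n}}"

lemma exps_add: "s \<in> exps n \<Longrightarrow> t \<in> exps n \<Longrightarrow> s + t \<in> exps n"
  using Poly_Mapping.keys_add[of s t] by blast

text \<open>Natural exponents cannot cancel.\<close>

lemma keys_add_nat: "Poly_Mapping.keys (s + t) = Poly_Mapping.keys s \<union> Poly_Mapping.keys (t :: nat \<Rightarrow>\<^sub>0 nat)"
  by (auto simp: in_keys_iff lookup_add)

lemma keys_split_off_single:
  fixes t :: "nat \<Rightarrow>\<^sub>0 nat"
  assumes "v \<in> Poly_Mapping.keys t"
  shows "t = (t - Poly_Mapping.single v 1) + Poly_Mapping.single v 1"
    "t \<in> exps n \<Longrightarrow> t - Poly_Mapping.single v 1 \<in> exps n"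
proof -
  show "t = (t - Poly_Mapping.single v 1) + Poly_Mapping.single v 1"
    using assms by (intro poly_mapping_eqI)
      (auto simp: lookup_add lookup_minus lookup_single when_def in_keys_iff)
  show "t - Poly_Mapping.single v 1 \<in> exps n" if "t \<in> exps n"
    using that by (auto simp: in_keys_iff lookup_minus subset_iff)
qed

text \<open>The ideals of the construction are handled through their exponent sets: products and
  cancellation reduce to statements about \<open>B\<close>.\<close>

definition monom_span :: "nat \<Rightarrow> (nat \<Rightarrow>\<^sub>0 nat) set \<Rightarrow> ((nat \<Rightarrow>\<^sub>0 nat) \<Rightarrow>\<^sub>0 'k::field) set" where
  "monom_span n B = {p \<in> carrier (mpoly_ring n). Poly_Mapping.keys p \<subseteq> B}"

lemma mpoly_ring_simps [simp]:
  "monoid.mult (mpoly_ring n) = (*)" "one (mpoly_ring n) = 1"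
  "ring.zero (mpoly_ring n) = 0" "add (mpoly_ring n) = (+)"
  by (simp_all add: mpoly_ring_def)

lemma in_carrier_mpoly_ring_iff: "p \<in> carrier (mpoly_ring n) \<longleftrightarrow> Poly_Mapping.keys p \<subseteq> exps n"
  by (auto simp: mpoly_ring_def)

lemma finsum_mpoly_ring:
  fixes g :: "'i \<Rightarrow> ((nat \<Rightarrow>\<^sub>0 nat) \<Rightarrow>\<^sub>0 'k::field)"
  assumes "\<And>i. i \<in> A \<Longrightarrow> g i \<in> carrier (mpoly_ring n)"
  shows "(\<Oplus>\<^bsub>mpoly_ring n\<^esub>i\<in>A. g i) = (\<Sum>i\<in>A. g i)"
proof -
  interpret cring "mpoly_ring n :: ((nat \<Rightarrow>\<^sub>0 nat) \<Rightarrow>\<^sub>0 'k) ring" by (rule cring_mpoly_ring)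
  show ?thesis using assms
    by (induction A rule: infinite_finite_induct) (auto simp: Pi_def)
qed

lemma carrier_closed:
  fixes p q :: "(nat \<Rightarrow>\<^sub>0 nat) \<Rightarrow>\<^sub>0 'k::field"
  assumes "p \<in> carrier (mpoly_ring n)" "q \<in> carrier (mpoly_ring n)"
  shows "p + q \<in> carrier (mpoly_ring n)" "p * q \<in> carrier (mpoly_ring n)"
    "p - q \<in> carrier (mpoly_ring n)"
proof -
  interpret cring "mpoly_ring n :: ((nat \<Rightarrow>\<^sub>0 nat) \<Rightarrow>\<^sub>0 'k) ring" by (rule cring_mpoly_ring)
  show "p + q \<in> carrier (mpoly_ring n)" "p * q \<in> carrier (mpoly_ring n)"
    using a_closed m_closed assms by auto
  show "p - q \<in> carrier (mpoly_ring n)"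
    using assms keys_diff[of p q] by (auto simp: in_carrier_mpoly_ring_iff)
qed

lemma uminus_in_carrier: "p \<in> carrier (mpoly_ring n) \<Longrightarrow> - p \<in> carrier (mpoly_ring n)"
  by (simp add: in_carrier_mpoly_ring_iff)

lemma monom_span_cong:
  "(\<And>t. t \<in> exps n \<Longrightarrow> t \<in> A \<longleftrightarrow> t \<in> B) \<Longrightarrow> monom_span n A = monom_span n B"
  unfolding monom_span_def in_carrier_mpoly_ring_iff by blast

lemma single_in_monom_span:
  "t \<in> B \<Longrightarrow> t \<in> exps n \<Longrightarrow> Poly_Mapping.single t c \<in> monom_span n B"
  by (auto simp: monom_span_def mpoly_ring_def)

lemma zero_in_monom_span [simp]: "0 \<in> monom_span n B"
  by (auto simp: monom_span_def mpoly_ring_def)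

lemma add_in_monom_span:
  "p \<in> monom_span n B \<Longrightarrow> q \<in> monom_span n B \<Longrightarrow> p + q \<in> monom_span n B"
  using Poly_Mapping.keys_add[of p q] by (auto simp: monom_span_def carrier_closed)

text \<open>Induction on the number of terms: subtracting the term at \<open>t\<close> removes
  exactly the key \<open>t\<close>.\<close>

lemma monom_span_induct [consumes 1, case_names zero add]:
  assumes "p \<in> monom_span n B"
    and "P 0" and "\<And>c t q. c \<noteq> 0 \<Longrightarrow> t \<in> B \<Longrightarrow> t \<in> exps n \<Longrightarrow> P q \<Longrightarrow> P (Poly_Mapping.single t c + q)"
  shows "P p"
  using assms(1)
proof (induction "card (Poly_Mapping.keys p)" arbitrary: p)
  case 0
  then show ?case using assms(2) by simp
next
  case (Suc k)
  then obtain t where t: "t \<in> Poly_Mapping.keys p"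
    by (metis Zero_not_Suc card.empty ex_in_conv)
  define c where "c = Poly_Mapping.lookup p t"
  define q where "q = p - Poly_Mapping.single t c"
  have q: "Poly_Mapping.keys q = Poly_Mapping.keys p - {t}"
    using t by (auto simp: q_def c_def in_keys_iff lookup_minus lookup_single when_def split: if_splits)
  have "P q" using Suc q t
    by (intro Suc.hyps) (auto simp: monom_span_def in_carrier_mpoly_ring_iff)
  moreover have "c \<noteq> 0" using t by (simp add: c_def in_keys_iff)
  ultimately have "P (Poly_Mapping.single t c + q)"
    using t Suc.prems by (intro assms(3)) (auto simp: monom_span_def in_carrier_mpoly_ring_iff)
  then show ?case by (simp add: q_def)
qed

lemma monom_span_mult:
  assumes "p \<in> monom_span n A" "q \<in> monom_span n B"
    and "\<And>s t. s \<in> A \<Longrightarrow> t \<in> B \<Longrightarrow> s \<in> exps n \<Longrightarrow> t \<in> exps n \<Longrightarrow> s + t \<in> D"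
  shows "p * q \<in> monom_span n D"
proof -
  have "Poly_Mapping.keys (p * q) \<subseteq> D"
  proof
    fix r assume "r \<in> Poly_Mapping.keys (p * q)"
    then obtain s t where "r = s + t" "s \<in> Poly_Mapping.keys p" "t \<in> Poly_Mapping.keys q"
      using keys_mult[of p q] by blast
    moreover from this have "s \<in> A" "t \<in> B" "s \<in> exps n" "t \<in> exps n"
      using assms(1,2) unfolding monom_span_def in_carrier_mpoly_ring_iff by blast+
    ultimately show "r \<in> D" by (simp only: assms(3))
  qed
  then show ?thesis using assms(1,2) carrier_closed(2)[of p n q] by (simp add: monom_span_def)
qed

section \<open>Ideals spanned by monomials\<close>

lemma carrier_eq_monom_span: "carrier (mpoly_ring n) = monom_span n UNIV"
  by (simp add: monom_span_def)

lemma ideal_monom_span: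
  assumes up: "\<And>s t. s \<in> B \<Longrightarrow> s \<in> exps n \<Longrightarrow> t \<in> exps n \<Longrightarrow> s + t \<in> B"
  shows "ideal (monom_span n B :: ((nat \<Rightarrow>\<^sub>0 nat) \<Rightarrow>\<^sub>0 'k::field) set) (mpoly_ring n)"
proof -
  interpret cring "mpoly_ring n :: ((nat \<Rightarrow>\<^sub>0 nat) \<Rightarrow>\<^sub>0 'k) ring" by (rule cring_mpoly_ring)
  have l: "x * a \<in> monom_span n B" if "a \<in> monom_span n B" "x \<in> carrier (mpoly_ring n)" for a x
    using that up unfolding carrier_eq_monom_span
    by (subst mult.commute) (rule monom_span_mult)
  show ?thesis
  proof (rule idealI)
    show "ring (mpoly_ring n :: ((nat \<Rightarrow>\<^sub>0 nat) \<Rightarrow>\<^sub>0 'k) ring)" by (rule ring_axioms)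
    show "subgroup (monom_span n B :: ((nat \<Rightarrow>\<^sub>0 nat) \<Rightarrow>\<^sub>0 'k) set) (add_monoid (mpoly_ring n))"
    proof (rule add.subgroupI)
      show "(monom_span n B :: ((nat \<Rightarrow>\<^sub>0 nat) \<Rightarrow>\<^sub>0 'k) set) \<noteq> {}"
        using zero_in_monom_span by blast
    next
      fix a :: "(nat \<Rightarrow>\<^sub>0 nat) \<Rightarrow>\<^sub>0 'k" assume a: "a \<in> monom_span n B"
      then have "\<ominus>\<^bsub>mpoly_ring n\<^esub> a = - a"
        by (intro minus_equality) (simp_all add: monom_span_def uminus_in_carrier)
      then show "\<ominus>\<^bsub>mpoly_ring n\<^esub> a \<in> monom_span n B"
        using a by (simp add: monom_span_def uminus_in_carrier)
    qed (simp_all add: add_in_monom_span, simp add: monom_span_def)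
  next
    fix a x :: "(nat \<Rightarrow>\<^sub>0 nat) \<Rightarrow>\<^sub>0 'k"
    assume ax: "a \<in> monom_span n B" "x \<in> carrier (mpoly_ring n)"
    then show "x \<otimes>\<^bsub>mpoly_ring n\<^esub> a \<in> monom_span n B" "a \<otimes>\<^bsub>mpoly_ring n\<^esub> x \<in> monom_span n B"
      using l[OF ax] by (simp_all add: mult.commute[of a x])
  qed
qed

text \<open>Every polynomial is the sum of its terms, and each term is a constant times a monomial
  of \<open>I\<close>.\<close>

lemma monom_span_subset_ideal:
  assumes I: "ideal I (mpoly_ring n)"
    and gen: "\<And>t. t \<in> B \<Longrightarrow> t \<in> exps n \<Longrightarrow> monomial t \<in> I"
  shows "monom_span n B \<subseteq> (I :: ((nat \<Rightarrow>\<^sub>0 nat) \<Rightarrow>\<^sub>0 'k::field) set)"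
proof
  interpret ideal I "mpoly_ring n :: ((nat \<Rightarrow>\<^sub>0 nat) \<Rightarrow>\<^sub>0 'k) ring" by (rule I)
  fix p :: "(nat \<Rightarrow>\<^sub>0 nat) \<Rightarrow>\<^sub>0 'k" assume "p \<in> monom_span n B"
  then show "p \<in> I"
  proof (induction rule: monom_span_induct)
    case zero
    show ?case using additive_subgroup.zero_closed[OF additive_subgroup_axioms] by simp
  next
    case (add c t q)
    have "Poly_Mapping.single 0 c \<otimes>\<^bsub>mpoly_ring n\<^esub> monomial t \<in> I"
      using add by (intro I_l_closed gen) (auto simp: mpoly_ring_def)
    then have "Poly_Mapping.single t c \<in> I" by (simp add: monomial_def mult_single)
    then show ?case using add additive_subgroup.a_closed[OF additive_subgroup_axioms] by simp
  qed
qed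

text \<open>The span of the multiples of \<open>A\<close> is an ideal containing the generators, and
  each of its monomials is a multiple of a generator.\<close>

lemma genideal_monomials:
  assumes A: "A \<subseteq> exps n"
    and B: "B = {s + t | s t. s \<in> A \<and> t \<in> exps n}"
  shows "Idl\<^bsub>mpoly_ring n\<^esub> (monomial ` A) = (monom_span n B :: ((nat \<Rightarrow>\<^sub>0 nat) \<Rightarrow>\<^sub>0 'k::field) set)"
proof -
  interpret cring "mpoly_ring n :: ((nat \<Rightarrow>\<^sub>0 nat) \<Rightarrow>\<^sub>0 'k) ring" by (rule cring_mpoly_ring)
  have carr: "monomial ` A \<subseteq> carrier (mpoly_ring n :: ((nat \<Rightarrow>\<^sub>0 nat) \<Rightarrow>\<^sub>0 'k) ring)"
    using A by (auto simp: monomial_def mpoly_ring_def)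
  have B_id: "ideal (monom_span n B) (mpoly_ring n :: ((nat \<Rightarrow>\<^sub>0 nat) \<Rightarrow>\<^sub>0 'k) ring)"
  proof (rule ideal_monom_span)
    fix s t assume "s \<in> B" and t: "t \<in> exps n"
    then obtain u v where "s = u + v" "u \<in> A" "v \<in> exps n" using B by auto
    then have "s + t = u + (v + t)" "v + t \<in> exps n" using exps_add t by (auto simp: add.assoc)
    then show "s + t \<in> B" using \<open>u \<in> A\<close> B by blast
  qed
  show ?thesis
  proof
    show "Idl\<^bsub>mpoly_ring n\<^esub> (monomial ` A) \<subseteq> (monom_span n B :: ((nat \<Rightarrow>\<^sub>0 nat) \<Rightarrow>\<^sub>0 'k) set)"
    proof (rule genideal_minimal[OF B_id], safe)
      fix t assume "t \<in> A"
      moreover have "t = t + 0" "0 \<in> exps n" by simp_all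
      ultimately have "t \<in> B" unfolding B by blast
      then show "monomial t \<in> monom_span n B"
        using \<open>t \<in> A\<close> A by (auto simp: monomial_def simp del: mem_Collect_eq intro!: single_in_monom_span)
    qed
    interpret G: ideal "Idl\<^bsub>mpoly_ring n\<^esub> (monomial ` A)" "mpoly_ring n :: ((nat \<Rightarrow>\<^sub>0 nat) \<Rightarrow>\<^sub>0 'k) ring"
      by (rule genideal_ideal[OF carr])
    show "(monom_span n B :: ((nat \<Rightarrow>\<^sub>0 nat) \<Rightarrow>\<^sub>0 'k) set) \<subseteq> Idl\<^bsub>mpoly_ring n\<^esub> (monomial ` A)"
    proof (rule monom_span_subset_ideal[OF G.is_ideal])
      fix r assume "r \<in> B"
      then obtain s t where r: "r = s + t" "s \<in> A" "t \<in> exps n" using B by auto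
      have "(monomial t :: (nat \<Rightarrow>\<^sub>0 nat) \<Rightarrow>\<^sub>0 'k) \<otimes>\<^bsub>mpoly_ring n\<^esub> monomial s \<in> Idl\<^bsub>mpoly_ring n\<^esub> (monomial ` A)"
        using r genideal_self[OF carr] by (intro G.I_l_closed) (auto simp: monomial_def mpoly_ring_def)
      then show "(monomial r :: (nat \<Rightarrow>\<^sub>0 nat) \<Rightarrow>\<^sub>0 'k) \<in> Idl\<^bsub>mpoly_ring n\<^esub> (monomial ` A)"
        by (simp add: monomial_def mult_single r add.commute)
    qed
  qed
qed

text \<open>A product of terms has its exponent in the sum set, and each monomial there is a product
  of two monomials. \<open>D\<close> is compared with the sum set on \<open>exps n\<close>, so that
  a closed description of it can be inserted.\<close>

lemma ideal_prod_monom_span: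
  assumes A: "\<And>s t. s \<in> A \<Longrightarrow> s \<in> exps n \<Longrightarrow> t \<in> exps n \<Longrightarrow> s + t \<in> A"
    and B: "\<And>s t. s \<in> B \<Longrightarrow> s \<in> exps n \<Longrightarrow> t \<in> exps n \<Longrightarrow> s + t \<in> B"
    and D: "\<And>r. r \<in> exps n \<Longrightarrow> r \<in> D \<longleftrightarrow> (\<exists>s t. s \<in> A \<and> t \<in> B \<and> s \<in> exps n \<and> t \<in> exps n \<and> r = s + t)"
  shows "monom_span n A \<cdot>\<^bsub>mpoly_ring n\<^esub> monom_span n B = (monom_span n D :: ((nat \<Rightarrow>\<^sub>0 nat) \<Rightarrow>\<^sub>0 'k::field) set)"
    (is "?P = _")
proof
  interpret cring "mpoly_ring n :: ((nat \<Rightarrow>\<^sub>0 nat) \<Rightarrow>\<^sub>0 'k) ring" by (rule cring_mpoly_ring)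
  show "?P \<subseteq> monom_span n D"
  proof
    fix p assume "p \<in> ?P"
    then show "p \<in> monom_span n D"
    proof induction
      case (prod i j)
      have "i * j \<in> monom_span n D"
      proof (rule monom_span_mult[OF prod])
        fix s t assume "s \<in> A" "t \<in> B" "s \<in> exps n" "t \<in> exps n"
        then show "s + t \<in> D" using D[of "s + t"] exps_add[of s n t] by blast
      qed
      then show ?case by simp
    qed (simp add: add_in_monom_span)
  qed
  show "monom_span n D \<subseteq> ?P"
  proof (rule monom_span_subset_ideal)
    show "ideal ?P (mpoly_ring n)"
      by (intro ideal_prod_is_ideal ideal_monom_span A B)
    fix r assume "r \<in> D" "r \<in> exps n"
    then obtain s t where st: "s \<in> A" "t \<in> B" "s \<in> exps n" "t \<in> exps n" "r = s + t"
      using D by blast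
    then have "monomial s \<in> (monom_span n A :: ((nat \<Rightarrow>\<^sub>0 nat) \<Rightarrow>\<^sub>0 'k) set)"
      "monomial t \<in> (monom_span n B :: ((nat \<Rightarrow>\<^sub>0 nat) \<Rightarrow>\<^sub>0 'k) set)"
      by (auto simp: monomial_def intro!: single_in_monom_span)
    from ideal_prod.prod[OF this, of "mpoly_ring n"]
    show "monomial r \<in> ?P" by (simp add: monomial_def mult_single st)
  qed
qed

lemma lookup_monomial_mult: "Poly_Mapping.lookup (monomial s * y) (s + t) = Poly_Mapping.lookup y t"
  by (simp add: monomial_def lookup_mult lookup_single when_mult)

text \<open>Multiplication by a monomial shifts exponents injectively, so no terms merge and
  cancellation can be tested on single exponents.\<close>

lemma monom_span_cancel_monomial:
  assumes up: "\<And>t. t \<in> exps n \<Longrightarrow> s + t \<in> B \<Longrightarrow> t \<in> B"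
    and y: "y \<in> carrier (mpoly_ring n)" "monomial s * y \<in> monom_span n B"
  shows "y \<in> monom_span n B"
proof -
  have "t \<in> B" if t: "t \<in> Poly_Mapping.keys y" for t
  proof -
    have "s + t \<in> Poly_Mapping.keys (monomial s * y)"
      using t by (simp add: in_keys_iff lookup_monomial_mult)
    then have "t \<in> exps n" "s + t \<in> B"
      using y t by (auto simp: monom_span_def in_carrier_mpoly_ring_iff)
    then show "t \<in> B" by (rule up)
  qed
  then show ?thesis using y by (auto simp: monom_span_def)
qed

section \<open>Depth of quotient modules\<close>

text \<open>\<open>finsum\<close> reads only carrier, addition and zero, which
  \<open>quot_module\<close> copies.\<close>

lemma finsum_quot_module: "finsum (quot_module R I) = finsum (R Quot I)"
  by (simp add: finsum_def finprod_def quot_module_def fun_eq_iff)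

text \<open>Lifting the coefficients from \<open>R Quot I\<close> to \<open>R\<close> turns
  membership in the submodule into membership in the ideal \<open>I + (xs)\<close>.\<close>

lemma (in ideal) coset_in_seq_smult_iff:
  assumes "cring R" and xs: "set xs \<subseteq> carrier R" and p: "p \<in> carrier R"
  shows "I +> p \<in> seq_smult (quot_module R I) xs \<longleftrightarrow>
    (\<exists>c \<in> {..<length xs} \<rightarrow> carrier R. p \<ominus> (\<Oplus>j\<in>{..<length xs}. c j \<otimes> xs ! j) \<in> I)"
proof -
  have carr: "carrier (R Quot I) = (+>) I ` carrier R"
    unfolding FactRing_def partial_object.simps A_RCOSETS_def' by blast
  interpret cring R by fact
  interpret h: ring_hom_cring R "R Quot I" "(+>) I"
    by (rule rcos_ring_hom_cring) fact
  let ?n = "{..<length xs}"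
  have nth: "xs ! j \<in> carrier R" if "j \<in> ?n" for j using that xs by auto
  have sum: "(\<Oplus>\<^bsub>quot_module R I\<^esub>j\<in>?n. xs ! j \<odot>\<^bsub>quot_module R I\<^esub> m j)
      = I +> (\<Oplus>j\<in>?n. c j \<otimes> xs ! j)"
    if c: "c \<in> ?n \<rightarrow> carrier R" and m: "\<And>j. j \<in> ?n \<Longrightarrow> m j = I +> c j" for c m
  proof -
    have "(\<Oplus>\<^bsub>R Quot I\<^esub>j\<in>?n. xs ! j \<odot>\<^bsub>quot_module R I\<^esub> m j)
      = (\<Oplus>\<^bsub>R Quot I\<^esub>j\<in>?n. ((+>) I \<circ> (\<lambda>j. c j \<otimes> xs ! j)) j)"
    proof (rule h.S.finsum_cong')
      fix j assume j: "j \<in> ?n"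
      then have cj: "c j \<in> carrier R" using c by auto
      have "xs ! j \<odot>\<^bsub>quot_module R I\<^esub> m j = (I +> xs ! j) \<otimes>\<^bsub>R Quot I\<^esub> (I +> c j)"
        using m[OF j] by (simp add: quot_module_def)
      also have "\<dots> = I +> (xs ! j \<otimes> c j)"
        using cj nth[OF j] by simp
      finally show "xs ! j \<odot>\<^bsub>quot_module R I\<^esub> m j = ((+>) I \<circ> (\<lambda>j. c j \<otimes> xs ! j)) j"
        using m_comm[OF nth[OF j] cj] by simp
    qed (use c nth in auto)
    also have "\<dots> = I +> (\<Oplus>j\<in>?n. c j \<otimes> xs ! j)"
      using c nth by (intro h.hom_finsum[symmetric]) auto
    finally show ?thesis by (simp add: finsum_quot_module)
  qed
  have eq: "I +> p = I +> s \<longleftrightarrow> p \<ominus> s \<in> I" if "s \<in> carrier R" for s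
    by (rule quotient_eq_iff_same_a_r_cos[OF is_ideal p that, symmetric])
  have s: "(\<Oplus>j\<in>?n. c j \<otimes> xs ! j) \<in> carrier R" if "c \<in> ?n \<rightarrow> carrier R" for c
    using that nth by (intro finsum_closed) auto
  show ?thesis
  proof
    assume "I +> p \<in> seq_smult (quot_module R I) xs"
    then obtain m where m: "m \<in> ?n \<rightarrow> carrier (R Quot I)"
      "I +> p = (\<Oplus>\<^bsub>quot_module R I\<^esub>j\<in>?n. xs ! j \<odot>\<^bsub>quot_module R I\<^esub> m j)"
      by (auto simp: seq_smult_def quot_module_def)
    have "\<forall>j\<in>?n. \<exists>c\<in>carrier R. m j = I +> c" using m(1) carr by blast
    then obtain c where "\<And>j. j \<in> ?n \<Longrightarrow> c j \<in> carrier R" "\<And>j. j \<in> ?n \<Longrightarrow> m j = I +> c j"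
      by metis
    then have c: "c \<in> ?n \<rightarrow> carrier R" "\<And>j. j \<in> ?n \<Longrightarrow> m j = I +> c j" by auto
    show "\<exists>c \<in> ?n \<rightarrow> carrier R. p \<ominus> (\<Oplus>j\<in>?n. c j \<otimes> xs ! j) \<in> I"
      using m(2) sum[OF c] eq[OF s[OF c(1)]] c(1) by auto
  next
    assume "\<exists>c \<in> ?n \<rightarrow> carrier R. p \<ominus> (\<Oplus>j\<in>?n. c j \<otimes> xs ! j) \<in> I"
    then obtain c where c: "c \<in> ?n \<rightarrow> carrier R" "p \<ominus> (\<Oplus>j\<in>?n. c j \<otimes> xs ! j) \<in> I" by blast
    have "I +> p = (\<Oplus>\<^bsub>quot_module R I\<^esub>j\<in>?n. xs ! j \<odot>\<^bsub>quot_module R I\<^esub> (I +> c j))"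
      using eq[OF s[OF c(1)]] c sum[OF c(1) refl] by simp
    moreover have "(\<lambda>j. I +> c j) \<in> ?n \<rightarrow> carrier (quot_module R I)"
      using c(1) carr by (auto simp: quot_module_def)
    ultimately show "I +> p \<in> seq_smult (quot_module R I) xs"
      unfolding seq_smult_def mem_Collect_eq by (intro exI conjI)
  qed
qed

text \<open>The ideal \<open>I + (x_0, ..., x_(i-1))\<close>. The coefficient function is total with
  all values in the carrier; partial choices are completed by \<open>0\<close>.\<close>

definition seq_ideal :: "nat \<Rightarrow> ((nat \<Rightarrow>\<^sub>0 nat) \<Rightarrow>\<^sub>0 'k::field) set \<Rightarrow> ((nat \<Rightarrow>\<^sub>0 nat) \<Rightarrow>\<^sub>0 'k) list \<Rightarrow>
    nat \<Rightarrow> ((nat \<Rightarrow>\<^sub>0 nat) \<Rightarrow>\<^sub>0 'k) set" where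
  "seq_ideal n I xs i =
    {g + (\<Sum>j<i. c j * xs ! j) | g c. g \<in> I \<and> (\<forall>j. c j \<in> carrier (mpoly_ring n))}"

lemma in_seq_ideal_nth:
  fixes I :: "((nat \<Rightarrow>\<^sub>0 nat) \<Rightarrow>\<^sub>0 'k::field) set"
  assumes "0 \<in> I" "j < i"
  shows "xs ! j \<in> seq_ideal n I xs i"
proof -
  let ?c = "\<lambda>l. if l = j then 1 else 0 :: (nat \<Rightarrow>\<^sub>0 nat) \<Rightarrow>\<^sub>0 'k"
  have "(\<Sum>l<i. ?c l * xs ! l) = (\<Sum>l<i. if l = j then xs ! l else 0)"
    by (intro sum.cong) auto
  then have "xs ! j = 0 + (\<Sum>l<i. ?c l * xs ! l)" using assms by simp
  moreover have "\<forall>l. ?c l \<in> carrier (mpoly_ring n)" by (simp add: in_carrier_mpoly_ring_iff)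
  ultimately show ?thesis
    using assms(1) unfolding seq_ideal_def mem_Collect_eq by (intro exI conjI)
qed

lemma subset_seq_ideal: "I \<subseteq> seq_ideal n I xs i"
proof
  fix p assume "p \<in> I"
  then have "p = p + (\<Sum>j<i. (\<lambda>_. 0) j * xs ! j)" "p \<in> I" by simp_all
  moreover have "\<forall>j. (\<lambda>_. 0) j \<in> carrier (mpoly_ring n)" by (simp add: in_carrier_mpoly_ring_iff)
  ultimately show "p \<in> seq_ideal n I xs i"
    unfolding seq_ideal_def mem_Collect_eq by (intro exI conjI)
qed

abbreviation var :: "nat \<Rightarrow> (nat \<Rightarrow>\<^sub>0 nat) \<Rightarrow>\<^sub>0 'k::field" where
  "var v \<equiv> monomial (Poly_Mapping.single v 1)"

lemma carrier_ring_mpoly: "carrier_ring (carrier (mpoly_ring n :: ((nat \<Rightarrow>\<^sub>0 nat) \<Rightarrow>\<^sub>0 'k::field) ring))"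
  by unfold_locales (auto simp: carrier_closed uminus_in_carrier, auto simp: mpoly_ring_def)

lemma carrier_ideal_mpoly:
  fixes I :: "((nat \<Rightarrow>\<^sub>0 nat) \<Rightarrow>\<^sub>0 'k::field) set"
  assumes "ideal I (mpoly_ring n)"
  shows "carrier_ideal (carrier (mpoly_ring n)) I"
proof -
  interpret carrier_ring "carrier (mpoly_ring n :: ((nat \<Rightarrow>\<^sub>0 nat) \<Rightarrow>\<^sub>0 'k) ring)"
    by (rule carrier_ring_mpoly)
  interpret I: ideal I "mpoly_ring n :: ((nat \<Rightarrow>\<^sub>0 nat) \<Rightarrow>\<^sub>0 'k) ring" by fact
  show ?thesis
    using I.a_subset additive_subgroup.zero_closed[OF I.additive_subgroup_axioms]
      additive_subgroup.a_closed[OF I.additive_subgroup_axioms] I.I_l_closed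
    by unfold_locales auto
qed

text \<open>Besides lifting coefficients, this replaces sums and differences of the ring structure
  by those of the type, as the Koszul lemmas expect.\<close>

lemma coset_in_seq_smult_iff_seq_ideal:
  fixes I :: "((nat \<Rightarrow>\<^sub>0 nat) \<Rightarrow>\<^sub>0 'k::field) set"
  assumes I: "ideal I (mpoly_ring n)" and xs: "set xs \<subseteq> carrier (mpoly_ring n)"
    and p: "p \<in> carrier (mpoly_ring n)" and i: "i \<le> length xs"
  shows "I +>\<^bsub>mpoly_ring n\<^esub> p \<in> seq_smult (quot_module (mpoly_ring n) I) (take i xs)
    \<longleftrightarrow> p \<in> seq_ideal n I xs i"
proof -
  let ?S = "mpoly_ring n :: ((nat \<Rightarrow>\<^sub>0 nat) \<Rightarrow>\<^sub>0 'k) ring"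
  interpret cring ?S by (rule cring_mpoly_ring)
  interpret ideal I ?S by fact
  have nth: "xs ! j \<in> carrier ?S" if "j < i" for j using that xs i by (auto simp: subset_iff)
  have len: "length (take i xs) = i" using i by simp
  have sum: "(\<Oplus>\<^bsub>?S\<^esub>j\<in>{..<i}. c j \<otimes>\<^bsub>?S\<^esub> take i xs ! j) = (\<Sum>j<i. c j * xs ! j)"
    "(\<Sum>j<i. c j * xs ! j) \<in> carrier ?S"
    if c: "\<And>j. j < i \<Longrightarrow> c j \<in> carrier ?S" for c
  proof -
    have in_c: "c j * xs ! j \<in> carrier ?S" if "j < i" for j
      using that c nth by (intro carrier_closed) auto
    have "(\<Oplus>\<^bsub>?S\<^esub>j\<in>{..<i}. c j \<otimes>\<^bsub>?S\<^esub> take i xs ! j) = (\<Oplus>\<^bsub>?S\<^esub>j\<in>{..<i}. c j * xs ! j)"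
      using in_c by (intro finsum_cong') auto
    then show 1: "(\<Oplus>\<^bsub>?S\<^esub>j\<in>{..<i}. c j \<otimes>\<^bsub>?S\<^esub> take i xs ! j) = (\<Sum>j<i. c j * xs ! j)"
      using in_c finsum_mpoly_ring[of "{..<i}" "\<lambda>j. c j * xs ! j" n] by simp
    show "(\<Sum>j<i. c j * xs ! j) \<in> carrier ?S"
      by (rule carrier_ring.sum_closed[OF carrier_ring_mpoly]) (simp add: in_c)
  qed
  have minus: "p \<ominus>\<^bsub>?S\<^esub> s = p - s" if "s \<in> carrier ?S" for s
  proof -
    have "\<ominus>\<^bsub>?S\<^esub> s = - s" using that by (intro minus_equality) (simp_all add: uminus_in_carrier)
    then show ?thesis by (simp add: a_minus_def)
  qed
  have "I +>\<^bsub>?S\<^esub> p \<in> seq_smult (quot_module ?S I) (take i xs) \<longleftrightarrow>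
    (\<exists>c \<in> {..<i} \<rightarrow> carrier ?S. p \<ominus>\<^bsub>?S\<^esub> (\<Oplus>\<^bsub>?S\<^esub>j\<in>{..<i}. c j \<otimes>\<^bsub>?S\<^esub> take i xs ! j) \<in> I)"
    using coset_in_seq_smult_iff[OF cring_mpoly_ring _ p, of "take i xs"] xs set_take_subset[of i xs]
    unfolding len by blast
  also have "\<dots> \<longleftrightarrow> (\<exists>c. (\<forall>j<i. c j \<in> carrier ?S) \<and> p - (\<Sum>j<i. c j * xs ! j) \<in> I)"
  proof -
    have "p \<ominus>\<^bsub>?S\<^esub> (\<Oplus>\<^bsub>?S\<^esub>j\<in>{..<i}. c j \<otimes>\<^bsub>?S\<^esub> take i xs ! j) = p - (\<Sum>j<i. c j * xs ! j)"
      if "\<forall>j<i. c j \<in> carrier ?S" for c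
      using that minus[OF sum(2)] sum(1) by simp
    then show ?thesis by (auto simp: Pi_def Bex_def simp del: mpoly_ring_simps)
  qed
  also have "\<dots> \<longleftrightarrow> p \<in> seq_ideal n I xs i"
  proof
    assume "\<exists>c. (\<forall>j<i. c j \<in> carrier ?S) \<and> p - (\<Sum>j<i. c j * xs ! j) \<in> I"
    then obtain c where c: "\<forall>j<i. c j \<in> carrier ?S" "p - (\<Sum>j<i. c j * xs ! j) \<in> I" by blast
    have "p = (p - (\<Sum>j<i. c j * xs ! j)) + (\<Sum>j<i. (if j < i then c j else 0) * xs ! j)" by simp
    moreover have "\<forall>j. (if j < i then c j else 0) \<in> carrier ?S"
      using c(1) zero_closed by auto
    ultimately show "p \<in> seq_ideal n I xs i"
      using c(2) unfolding seq_ideal_def mem_Collect_eq by (intro exI conjI)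
  next
    assume "p \<in> seq_ideal n I xs i"
    then obtain g c where "p = g + (\<Sum>j<i. c j * xs ! j)" "g \<in> I" "\<forall>j. c j \<in> carrier ?S"
      by (auto simp: seq_ideal_def)
    then show "\<exists>c. (\<forall>j<i. c j \<in> carrier ?S) \<and> p - (\<Sum>j<i. c j * xs ! j) \<in> I"
      by (intro exI[of _ c]) simp
  qed
  finally show ?thesis .
qed

section \<open>The graded maximal ideal and ideals of sequences\<close>

lemma graded_max_ideal_eq:
  "graded_max_ideal n = (monom_span n {t. t \<noteq> 0} :: ((nat \<Rightarrow>\<^sub>0 nat) \<Rightarrow>\<^sub>0 'k::field) set)"
proof -
  let ?A = "(\<lambda>i. Poly_Mapping.single i (1::nat)) ` {..<n}"
  let ?B = "{s + t | s t. s \<in> ?A \<and> t \<in> exps n}"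
  have "?A \<subseteq> exps n" by auto
  from genideal_monomials[OF this refl]
  have *: "Idl\<^bsub>mpoly_ring n\<^esub> (monomial ` ?A) = (monom_span n ?B :: ((nat \<Rightarrow>\<^sub>0 nat) \<Rightarrow>\<^sub>0 'k) set)" .
  have "graded_max_ideal n = (monom_span n ?B :: ((nat \<Rightarrow>\<^sub>0 nat) \<Rightarrow>\<^sub>0 'k) set)"
    unfolding *[symmetric] by (simp only: graded_max_ideal_def image_image)
  also have "\<dots> = monom_span n {t. t \<noteq> 0}"
  proof -
    have "t \<in> ?B \<longleftrightarrow> t \<noteq> 0" if t: "t \<in> exps n" for t
    proof
      assume "t \<in> ?B"
      then obtain i t' where "t = Poly_Mapping.single i 1 + t'" by auto
      then have "Poly_Mapping.lookup t i \<noteq> 0" by (simp add: lookup_add)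
      then show "t \<noteq> 0" by auto
    next
      assume "t \<noteq> 0"
      then obtain i where i: "i \<in> Poly_Mapping.keys t" by fastforce
      have "t = Poly_Mapping.single i 1 + (t - Poly_Mapping.single i 1)"
        using keys_split_off_single(1)[OF i] by (simp only: add.commute)
      moreover have "t - Poly_Mapping.single i 1 \<in> exps n"
        by (rule keys_split_off_single(2)[OF i t])
      moreover have "i < n" using i t by auto
      ultimately show "t \<in> ?B" by blast
    qed
    then show ?thesis by (intro monom_span_cong) blast
  qed
  finally show ?thesis .
qed

lemma ideal_graded_max_ideal:
  "ideal (graded_max_ideal n :: ((nat \<Rightarrow>\<^sub>0 nat) \<Rightarrow>\<^sub>0 'k::field) set) (mpoly_ring n)"
proof -
  interpret cring "mpoly_ring n :: ((nat \<Rightarrow>\<^sub>0 nat) \<Rightarrow>\<^sub>0 'k) ring" by (rule cring_mpoly_ring)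
  show ?thesis unfolding graded_max_ideal_def
    by (rule genideal_ideal) (auto simp: monomial_def in_carrier_mpoly_ring_iff)
qed

lemma graded_max_ideal_vars:
  assumes "p \<in> graded_max_ideal n"
  shows "\<exists>e. (\<forall>v<n. e v \<in> carrier (mpoly_ring n)) \<and> p = (\<Sum>v<n. e v * var v)"
  using assms unfolding graded_max_ideal_eq
proof (induction rule: monom_span_induct)
  case zero
  then show ?case by (intro exI[of _ "\<lambda>_. 0"]) (simp add: in_carrier_mpoly_ring_iff)
next
  case (add c t q)
  then obtain e where e: "\<forall>v<n. e v \<in> carrier (mpoly_ring n)" "q = (\<Sum>v<n. e v * var v)" by blast
  from add obtain i where i: "i \<in> Poly_Mapping.keys t" by fastforce
  define s where "s = t - Poly_Mapping.single i 1"
  have t: "t = s + Poly_Mapping.single i 1" and s: "s \<in> exps n"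
    unfolding s_def using keys_split_off_single[OF i] add(3) by blast+
  have "i < n" using i add(3) by auto
  \<comment> \<open>The term is charged to one variable \<open>i\<close> dividing it: its cofactor
    \<open>s\<close> joins the coefficient of that variable.\<close>
  let ?e = "e(i := Poly_Mapping.single s c + e i)"
  have "(\<Sum>v<n. ?e v * var v) = ?e i * var i + (\<Sum>v\<in>{..<n} - {i}. e v * var v)"
    using \<open>i < n\<close> by (subst sum.remove[of _ i]) auto
  also have "\<dots> = Poly_Mapping.single t c + (\<Sum>v<n. e v * var v)"
    using \<open>i < n\<close> by (subst (2) sum.remove[of _ i]) (auto simp: distrib_right t monomial_def mult_single add.assoc)
  finally have "Poly_Mapping.single t c + q = (\<Sum>v<n. ?e v * var v)" using e by simp
  moreover have "\<forall>v<n. ?e v \<in> carrier (mpoly_ring n)"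
    using e(1) s \<open>i < n\<close> by (auto intro!: carrier_closed(1) simp: in_carrier_mpoly_ring_iff[of "Poly_Mapping.single s c"])
  ultimately show ?case by blast
qed

text \<open>\<open>J\<close> is an upper bound for the ideal of the sequence. With the graded
  maximal ideal it yields properness, with a monomial ideal one inclusion of
  \<open>seq_ideal_vars\<close>.\<close>

lemma carrier_ideal_seq_ideal:
  fixes I :: "((nat \<Rightarrow>\<^sub>0 nat) \<Rightarrow>\<^sub>0 'k::field) set"
  assumes J: "carrier_ideal (carrier (mpoly_ring n)) J"
    and I: "carrier_ideal (carrier (mpoly_ring n)) I" "I \<subseteq> J" and xs: "\<And>j. j < i \<Longrightarrow> xs ! j \<in> J"
  shows "carrier_ideal (carrier (mpoly_ring n)) (seq_ideal n I xs i)" "seq_ideal n I xs i \<subseteq> J"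
proof -
  let ?C = "carrier (mpoly_ring n :: ((nat \<Rightarrow>\<^sub>0 nat) \<Rightarrow>\<^sub>0 'k) ring)"
  interpret J: carrier_ideal ?C J by fact
  interpret I: carrier_ideal ?C I by fact
  show sub: "seq_ideal n I xs i \<subseteq> J"
  proof
    fix p assume "p \<in> seq_ideal n I xs i"
    then obtain g c where gc: "p = g + (\<Sum>j<i. c j * xs ! j)" "g \<in> I" "\<forall>j. c j \<in> ?C"
      by (auto simp: seq_ideal_def)
    show "p \<in> J" unfolding gc(1)
    proof (rule J.ideal_add)
      show "g \<in> J" using gc \<open>I \<subseteq> J\<close> by auto
      show "(\<Sum>j<i. c j * xs ! j) \<in> J"
        using gc(3) xs by (intro J.ideal_sum J.ideal_mult) auto
    qed
  qed
  show "carrier_ideal ?C (seq_ideal n I xs i)"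
  proof (unfold_locales)
    show "seq_ideal n I xs i \<subseteq> ?C" using sub J.ideal_subset by blast
    show "0 \<in> seq_ideal n I xs i" unfolding seq_ideal_def
      using I.ideal_zero J.zero_closed by (auto intro!: exI[of _ "0::(nat \<Rightarrow>\<^sub>0 nat) \<Rightarrow>\<^sub>0 'k"] exI[of _ "\<lambda>_. 0"])
  next
    fix a b assume "a \<in> seq_ideal n I xs i" "b \<in> seq_ideal n I xs i"
    then obtain g c h d where *: "a = g + (\<Sum>j<i. c j * xs ! j)" "g \<in> I" "\<forall>j. c j \<in> ?C"
      "b = h + (\<Sum>j<i. d j * xs ! j)" "h \<in> I" "\<forall>j. d j \<in> ?C"
      by (auto simp: seq_ideal_def)
    then have "a + b = (g + h) + (\<Sum>j<i. (c j + d j) * xs ! j)" "g + h \<in> I" "\<forall>j. c j + d j \<in> ?C"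
      by (simp_all add: sum.distrib distrib_right I.ideal_add J.add_closed)
    then show "a + b \<in> seq_ideal n I xs i" unfolding seq_ideal_def mem_Collect_eq by (intro exI conjI)
  next
    fix a b assume "a \<in> ?C" "b \<in> seq_ideal n I xs i"
    then obtain h d where *: "b = h + (\<Sum>j<i. d j * xs ! j)" "h \<in> I" "\<forall>j. d j \<in> ?C"
      by (auto simp: seq_ideal_def)
    then have "a * b = a * h + (\<Sum>j<i. (a * d j) * xs ! j)" "a * h \<in> I" "\<forall>j. a * d j \<in> ?C"
      using \<open>a \<in> ?C\<close> by (simp_all add: distrib_left sum_distrib_left mult.assoc I.ideal_mult J.mult_closed)
    then show "a * b \<in> seq_ideal n I xs i" unfolding seq_ideal_def mem_Collect_eq by (intro exI conjI)
  qed
qed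

section \<open>Regular sequences and depth of quotients\<close>

lemma regular_sequence_quot_module_iff:
  fixes I :: "((nat \<Rightarrow>\<^sub>0 nat) \<Rightarrow>\<^sub>0 'k::field) set"
  assumes I: "ideal I (mpoly_ring n)" and xs: "set xs \<subseteq> carrier (mpoly_ring n)"
  shows "regular_sequence (mpoly_ring n) (quot_module (mpoly_ring n) I) xs \<longleftrightarrow>
    (\<forall>i<length xs. \<forall>y\<in>carrier (mpoly_ring n). xs ! i * y \<in> seq_ideal n I xs i \<longrightarrow> y \<in> seq_ideal n I xs i)
    \<and> seq_smult (quot_module (mpoly_ring n) I) xs \<noteq> carrier (quot_module (mpoly_ring n) I)"
proof -
  let ?S = "mpoly_ring n :: ((nat \<Rightarrow>\<^sub>0 nat) \<Rightarrow>\<^sub>0 'k) ring"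
  let ?M = "quot_module ?S I"
  interpret ideal I ?S by fact
  have carr: "carrier ?M = (\<lambda>y. I +>\<^bsub>?S\<^esub> y) ` carrier ?S"
    unfolding quot_module_def FactRing_def partial_object.simps A_RCOSETS_def' by blast
  interpret h: ring_hom_cring ?S "?S Quot I" "(\<lambda>y. I +>\<^bsub>?S\<^esub> y)"
    by (rule rcos_ring_hom_cring) (rule cring_mpoly_ring)
  have smult: "xs ! i \<odot>\<^bsub>?M\<^esub> (I +>\<^bsub>?S\<^esub> y) \<in> seq_smult ?M (take i xs) \<longleftrightarrow> xs ! i * y \<in> seq_ideal n I xs i"
    if "i < length xs" "y \<in> carrier ?S" for i y
  proof -
    have "xs ! i \<in> carrier ?S" using that xs by auto
    then have "xs ! i \<odot>\<^bsub>?M\<^esub> (I +>\<^bsub>?S\<^esub> y) = I +>\<^bsub>?S\<^esub> (xs ! i * y)" "xs ! i * y \<in> carrier ?S"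
      using h.hom_mult[OF _ that(2), of "xs ! i"] that
      by (simp_all add: quot_module_def carrier_closed)
    then show ?thesis
      using coset_in_seq_smult_iff_seq_ideal[OF I xs, of "xs ! i * y" i] that by simp
  qed
  have "(\<forall>y\<in>carrier ?M. xs ! i \<odot>\<^bsub>?M\<^esub> y \<in> seq_smult ?M (take i xs) \<longrightarrow> y \<in> seq_smult ?M (take i xs))
    \<longleftrightarrow> (\<forall>y\<in>carrier ?S. xs ! i * y \<in> seq_ideal n I xs i \<longrightarrow> y \<in> seq_ideal n I xs i)"
    if "i < length xs" for i
    unfolding carr ball_simps
    using smult[OF that] coset_in_seq_smult_iff_seq_ideal[OF I xs, of _ i] that
    by (intro ball_cong refl) simp
  then show ?thesis unfolding regular_sequence_def using xs by simp
qed

text \<open>The variables in \<open>vs\<close> form a regular sequence, which bounds the depth from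
  below. Modulo these variables \<open>w\<close> is a nonzero socle element, and
  \<open>regular_length_le_card\<close> with \<open>Z = set vs\<close> bounds every regular sequence
  from above.\<close>

lemma depth_quot_module_eqI:
  fixes I :: "((nat \<Rightarrow>\<^sub>0 nat) \<Rightarrow>\<^sub>0 'k::field) set"
  assumes I: "ideal I (mpoly_ring n)" "I \<subseteq> graded_max_ideal n"
    and vs: "set vs \<subseteq> {..<n}" "distinct vs"
    and regular: "\<And>i y. i < length vs \<Longrightarrow> y \<in> carrier (mpoly_ring n) \<Longrightarrow>
      var (vs ! i) * y \<in> seq_ideal n I (map var vs) i \<Longrightarrow> y \<in> seq_ideal n I (map var vs) i"
    and w: "w \<in> carrier (mpoly_ring n)" "\<And>v. v < n \<Longrightarrow> v \<notin> set vs \<Longrightarrow> var v * w \<in> I"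
      "w \<notin> seq_ideal n I (map var vs) (length vs)"
  shows "depth (mpoly_ring n) (graded_max_ideal n) (quot_module (mpoly_ring n) I) = enat (length vs)"
proof -
  let ?S = "mpoly_ring n :: ((nat \<Rightarrow>\<^sub>0 nat) \<Rightarrow>\<^sub>0 'k) ring"
  let ?M = "quot_module ?S I"
  let ?m = "graded_max_ideal n :: ((nat \<Rightarrow>\<^sub>0 nat) \<Rightarrow>\<^sub>0 'k) set"
  interpret C: carrier_ring "carrier ?S" by (rule carrier_ring_mpoly)
  have cI: "carrier_ideal (carrier ?S) I" by (rule carrier_ideal_mpoly) fact
  have cm: "carrier_ideal (carrier ?S) ?m" by (rule carrier_ideal_mpoly) (rule ideal_graded_max_ideal)
  have m_carr: "?m \<subseteq> carrier ?S" by (rule carrier_ideal.ideal_subset[OF cm])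
  have var_m: "var v \<in> ?m" if "v < n" for v
  proof -
    have "Poly_Mapping.lookup (Poly_Mapping.single v (1::nat)) v \<noteq> Poly_Mapping.lookup 0 v" by simp
    then have "Poly_Mapping.single v (1::nat) \<noteq> 0" by metis
    then show ?thesis
      unfolding graded_max_ideal_eq monomial_def using that by (intro single_in_monom_span) auto
  qed
  \<comment> \<open>The unit lies outside the graded maximal ideal, which contains
    \<open>I + (xs)\<close>. So its coset shows both the properness required of regular sequences
    and that the depth is not infinite by convention.\<close>
  have proper: "I +>\<^bsub>?S\<^esub> 1 \<in> carrier ?M - seq_smult ?M xs" if xs: "set xs \<subseteq> ?m" for xs
  proof
    show "I +>\<^bsub>?S\<^esub> 1 \<in> carrier ?M"
      unfolding quot_module_def FactRing_def partial_object.simps A_RCOSETS_def' using C.one_closed by blast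
    have "seq_ideal n I xs (length xs) \<subseteq> ?m"
      using xs by (intro carrier_ideal_seq_ideal cI cm I) auto
    moreover have "1 \<notin> ?m" by (simp add: graded_max_ideal_eq monom_span_def)
    ultimately show "I +>\<^bsub>?S\<^esub> 1 \<notin> seq_smult ?M xs"
      using coset_in_seq_smult_iff_seq_ideal[OF I(1) _ C.one_closed order.refl, of xs] xs m_carr by auto
  qed
  have "I +>\<^bsub>?S\<^esub> 1 \<in> carrier ?M" using proper[of "[]"] by auto
  moreover have "I +>\<^bsub>?S\<^esub> 1 \<notin> (\<Union>xs \<in> lists ?m. seq_smult ?M xs)"
    using proper by (auto simp: in_lists_conv_set subset_iff)
  ultimately have ne: "(\<Union>xs \<in> lists ?m. seq_smult ?M xs) \<noteq> carrier ?M" by blast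
  have le: "length xs \<le> length vs" if xs: "set xs \<subseteq> ?m" and reg: "regular_sequence ?S ?M xs" for xs
  proof -
    have xs_carr: "set xs \<subseteq> carrier ?S" using xs m_carr by blast
    have nth: "xs ! j \<in> ?m" if "j < length xs" for j using xs that by auto
    let ?J = "seq_ideal n I xs"
    have "length xs \<le> card (set vs)"
    proof (rule C.regular_length_le_card[where V = "{..<n}" and X = var and J = ?J and a = "(!) xs" and w = w])
      show "finite {..<n}" by simp
      show "var v \<in> carrier ?S" if "v \<in> {..<n}" for v using var_m m_carr that by auto
      show "carrier_ideal (carrier ?S) (?J i)" if "i \<le> length xs" for i
        by (rule carrier_ideal_seq_ideal[OF cm cI I(2)]) (use nth that in auto)
      show "\<exists>y\<in>carrier ?S. p - xs ! i * y \<in> ?J i" if "p \<in> ?J (Suc i)" for i p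
      proof -
        obtain g c where gc: "p = g + (\<Sum>j<Suc i. c j * xs ! j)" "g \<in> I" "\<forall>j. c j \<in> carrier ?S"
          using \<open>p \<in> ?J (Suc i)\<close> by (auto simp: seq_ideal_def)
        then have "p - xs ! i * c i = g + (\<Sum>j<i. c j * xs ! j)" by simp
        then have "p - xs ! i * c i \<in> ?J i" using gc unfolding seq_ideal_def by blast
        then show ?thesis using gc by blast
      qed
      show "?J i \<subseteq> ?J (Suc i)" for i
      proof
        fix p assume "p \<in> ?J i"
        then obtain g c where gc: "p = g + (\<Sum>j<i. c j * xs ! j)" "g \<in> I" "\<forall>j. c j \<in> carrier ?S"
          by (auto simp: seq_ideal_def)
        then have "p = g + (\<Sum>j<Suc i. (c(i := 0)) j * xs ! j)" "\<forall>j. (c(i := 0)) j \<in> carrier ?S"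
          using C.zero_closed by auto
        then show "p \<in> ?J (Suc i)" using gc(2) unfolding seq_ideal_def mem_Collect_eq by (intro exI conjI)
      qed
      show "xs ! i \<in> ?J (Suc i)" for i
        by (intro in_seq_ideal_nth carrier_ideal.ideal_zero[OF cI]) simp
      show "\<exists>e. (\<forall>v\<in>{..<n}. e v \<in> carrier ?S) \<and> xs ! i = (\<Sum>v\<in>{..<n}. e v * var v)" if "i < length xs" for i
        using graded_max_ideal_vars[OF nth[OF that]] by auto
      show "y \<in> ?J i" if "i < length xs" "y \<in> carrier ?S" "xs ! i * y \<in> ?J i" for i y
        using reg that unfolding regular_sequence_quot_module_iff[OF I(1) xs_carr] by blast
      show "set vs \<subseteq> {..<n}" "w \<in> carrier ?S" by fact+
      show "var v * w \<in> ?J 0" if "v \<in> {..<n} - set vs" for v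
        using w(2)[of v] that C.zero_closed by (auto simp: seq_ideal_def)
      show "w - (\<Sum>v\<in>set vs. c v * var v) \<notin> ?J 0" if "\<And>v. v \<in> set vs \<Longrightarrow> c v \<in> carrier ?S" for c
      proof
        assume "w - (\<Sum>v\<in>set vs. c v * var v) \<in> ?J 0"
        then have "w - (\<Sum>v\<in>set vs. c v * var v) \<in> I" by (auto simp: seq_ideal_def)
        \<comment> \<open>Passing from the set to list positions, by distinctness of
          \<open>vs\<close>, brings the combination into the form of
          \<open>seq_ideal\<close>.\<close>
        moreover have "(\<Sum>v\<in>set vs. c v * var v) = (\<Sum>j<length vs. c (vs ! j) * var (vs ! j))"
          using bij_betw_nth[OF vs(2) refl refl] by (rule sum.reindex_bij_betw[symmetric])
        moreover have "\<dots> = (\<Sum>j<length vs. (if j < length vs then c (vs ! j) else 0) * map var vs ! j)"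
          by (intro sum.cong) auto
        ultimately have "w - (\<Sum>j<length vs. (if j < length vs then c (vs ! j) else 0) * map var vs ! j) \<in> I"
          by simp
        moreover have "\<forall>j. (if j < length vs then c (vs ! j) else 0) \<in> carrier ?S"
          using that C.zero_closed by auto
        moreover have "w = (w - (\<Sum>j<length vs. (if j < length vs then c (vs ! j) else 0) * map var vs ! j)) +
            (\<Sum>j<length vs. (if j < length vs then c (vs ! j) else 0) * map var vs ! j)" by simp
        ultimately have "w \<in> seq_ideal n I (map var vs) (length vs)"
          unfolding seq_ideal_def mem_Collect_eq by (intro exI conjI)
        then show False using w by blast
      qed
    qed
    then show ?thesis using card_length[of vs] by simp
  qed
  have vs_m: "set (map var vs) \<subseteq> ?m" using vs var_m by auto
  have "regular_sequence ?S ?M (map var vs)"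
    using regular_sequence_quot_module_iff[OF I(1), of "map var vs"] vs_m m_carr proper[OF vs_m] regular
    by auto
  then have "enat (length vs) \<in> (\<lambda>xs. enat (length xs)) ` {xs \<in> lists ?m. regular_sequence ?S ?M xs}"
    using vs_m by (intro image_eqI[of _ _ "map var vs"]) (auto simp: in_lists_conv_set)
  then have "(SUP xs \<in> {xs \<in> lists ?m. regular_sequence ?S ?M xs}. enat (length xs)) = enat (length vs)"
    using le by (intro antisym Sup_upper SUP_least) (auto simp: in_lists_conv_set subset_iff)
  then show ?thesis using ne by (simp add: depth_def)
qed

text \<open>A monomial of the right side outside \<open>B\<close> is a cofactor times some variable
  \<open>vs ! j\<close>. The ideals thus stay monomial along the sequence, and regularity becomes a
  question about exponents.\<close>

lemma seq_ideal_vars: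
  assumes up: "\<And>s t. s \<in> B \<Longrightarrow> s \<in> exps n \<Longrightarrow> t \<in> exps n \<Longrightarrow> s + t \<in> B"
    and vs: "set vs \<subseteq> {..<n}" and i: "i \<le> length vs"
  shows "seq_ideal n (monom_span n B) (map var vs) i
    = (monom_span n (B \<union> {t. \<exists>j<i. vs ! j \<in> Poly_Mapping.keys t}) :: ((nat \<Rightarrow>\<^sub>0 nat) \<Rightarrow>\<^sub>0 'k::field) set)"
    (is "_ = ?J")
proof
  let ?I = "monom_span n B :: ((nat \<Rightarrow>\<^sub>0 nat) \<Rightarrow>\<^sub>0 'k) set"
  have cI: "carrier_ideal (carrier (mpoly_ring n)) ?I"
    by (intro carrier_ideal_mpoly ideal_monom_span up)
  have cJ: "carrier_ideal (carrier (mpoly_ring n)) ?J"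
  proof (intro carrier_ideal_mpoly ideal_monom_span)
    fix s t assume "s \<in> B \<union> {t. \<exists>j<i. vs ! j \<in> Poly_Mapping.keys t}" "s \<in> exps n" "t \<in> exps n"
    then show "s + t \<in> B \<union> {t. \<exists>j<i. vs ! j \<in> Poly_Mapping.keys t}"
      using up[of s t] by (auto simp: keys_add_nat)
  qed
  have IJ: "?I \<subseteq> ?J" by (auto simp: monom_span_def)
  have v: "vs ! j < n" if "j < i" for j using that vs i by (auto simp: subset_iff)
  have xs: "map var vs ! j \<in> ?J" if "j < i" for j
  proof -
    have "Poly_Mapping.single (vs ! j) 1 \<in> B \<union> {t. \<exists>j<i. vs ! j \<in> Poly_Mapping.keys t}"
      "Poly_Mapping.single (vs ! j) (1::nat) \<in> exps n" using that v[OF that] by auto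
    then have "var (vs ! j) \<in> ?J" unfolding monomial_def by (rule single_in_monom_span)
    then show ?thesis using that i by simp
  qed
  show "seq_ideal n ?I (map var vs) i \<subseteq> ?J"
    by (rule carrier_ideal_seq_ideal(2)[OF cJ cI IJ xs])
  interpret S: carrier_ideal "carrier (mpoly_ring n)" "seq_ideal n ?I (map var vs) i"
    by (rule carrier_ideal_seq_ideal(1)[OF cJ cI IJ xs])
  show "?J \<subseteq> seq_ideal n ?I (map var vs) i"
  proof
    fix p assume "p \<in> ?J"
    then show "p \<in> seq_ideal n ?I (map var vs) i"
    proof (induction rule: monom_span_induct)
      case zero
      show ?case by (rule S.ideal_zero)
    next
      case (add c t q)
      have "Poly_Mapping.single t c \<in> seq_ideal n ?I (map var vs) i"
      proof (cases "t \<in> B")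
        case True
        then have "Poly_Mapping.single t c \<in> ?I" using add by (intro single_in_monom_span)
        then show ?thesis using subset_seq_ideal by blast
      next
        case False
        then obtain j where j: "j < i" "vs ! j \<in> Poly_Mapping.keys t" using add by auto
        let ?s = "t - Poly_Mapping.single (vs ! j) 1"
        have "Poly_Mapping.single ?s c * (map var vs ! j) \<in> seq_ideal n ?I (map var vs) i"
        proof (rule S.ideal_mult)
          show "Poly_Mapping.single ?s c \<in> carrier (mpoly_ring n)"
            using keys_split_off_single(2)[OF j(2) add(3)] by (simp add: in_carrier_mpoly_ring_iff)
          show "map var vs ! j \<in> seq_ideal n ?I (map var vs) i"
            using j by (intro in_seq_ideal_nth) simp_all
        qed
        moreover have "Poly_Mapping.single ?s c * (map var vs ! j) = Poly_Mapping.single t c"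
          using j i keys_split_off_single(1)[OF j(2)] by (simp add: monomial_def mult_single)
        ultimately show ?thesis by simp
      qed
      then show ?case using add by (intro S.ideal_add)
    qed
  qed
qed

section \<open>Staircase ideals\<close>

lemma div_add_superadditive: "a div m + b div m \<le> (a + b) div (m::nat)"
  by (simp add: div_add1_eq[of a b m])

text \<open>Each remainder is at most \<open>m - 1\<close>.\<close>

lemma le_mult_div_add: "0 < m \<Longrightarrow> p + q + 2 \<le> m * (p div m + q div m) + 2 * (m::nat)"
proof -
  assume m: "0 < m"
  have "p = m * (p div m) + p mod m" "q = m * (q div m) + q mod m" by simp_all
  moreover have "p mod m < m" "q mod m < m" using m by simp_all
  ultimately have "p + q + 2 \<le> m * (p div m) + m * (q div m) + 2 * m" by linarith
  then show ?thesis by (simp add: distrib_left)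
qed

lemma diff_div_same: "m \<le> p \<Longrightarrow> (p - m) div m = p div m - (1::nat)" if "0 < m"
  using le_div_geq[OF that] by fastforce

lemma pred_div: "0 < p mod m \<Longrightarrow> (p - 1) div m = p div (m::nat)"
  by (metis Suc_diff_1 Suc_pred' div_Suc gr0I mod_0 nat_less_le not_less_zero)

lemma pred_div_dvd: "0 < p \<Longrightarrow> p mod m = 0 \<Longrightarrow> (p - 1) div m = p div (m::nat) - 1"
  by (metis Suc_pred' diff_Suc_1 div_Suc)

lemma bounded_ex2I: "c \<le> p \<Longrightarrow> d \<le> q \<Longrightarrow> P c d \<Longrightarrow> \<exists>c\<le>(p::nat). \<exists>d\<le>(q::nat). P c d"
  by blast

text \<open>\<open>(c, d)\<close> is the exponent of one of the generators \<open>x^(m+1)\<close>,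
  \<open>x^m y\<close>, \<open>x y^m\<close>, \<open>y^(m+1)\<close>. A positive remainder supplies
  the extra factor \<open>x\<close> or \<open>y\<close>, so only one block of length
  \<open>m\<close> is lost.\<close>

lemma split_off_one:
  fixes p q m :: nat
  assumes m: "2 \<le> m" and D: "1 \<le> p div m + q div m" and r: "0 < p mod m \<or> 0 < q mod m"
  shows "\<exists>c\<le>p. \<exists>d\<le>q. c + d = m + 1 \<and> 1 \<le> c div m + d div m \<and>
    (p - c) div m + (q - d) div m + 1 = p div m + q div m"
proof -
  have m1: "1 \<le> (m + 1) div m" using m by (simp add: less_eq_div_iff_mult_less_eq)
  \<comment> \<open>Up to exchanging \<open>p\<close> and \<open>q\<close>, the first exponent
    contains a block. The extra unit is taken where the remainder is positive.\<close>
  have *: "\<exists>c\<le>p. \<exists>d\<le>q. c + d = m + 1 \<and> 1 \<le> c div m + d div m \<and>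
    (p - c) div m + (q - d) div m + 1 = p div m + q div m"
    if r: "0 < p mod m \<or> 0 < q mod m" and p: "m \<le> p" for p q
  proof (cases "0 < p mod m")
    case True
    then have "p \<noteq> m" by auto
    then have le: "m + 1 \<le> p" using p by simp
    have pm: "1 \<le> p div m" using p m by (simp add: div_greater_zero_iff Suc_leI)
    have "(p - m) mod m = p mod m" using p by (simp add: le_mod_geq)
    then have "(p - m - 1) div m = p div m - 1"
      using True m p pred_div[of "p - m" m] diff_div_same[of m p] by simp
    then show ?thesis using le m pm m1 by (intro bounded_ex2I[of "m + 1" _ 0]) auto
  next
    case False
    then have q: "0 < q mod m" using r by simp
    then have "0 < q" by (metis gr0I mod_0)
    have pm: "1 \<le> p div m" using p m by (simp add: div_greater_zero_iff Suc_leI)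
    have "(p - m) div m = p div m - 1" "(q - 1) div m = q div m"
      using q m p pred_div[of q m] diff_div_same[of m p] by simp_all
    then show ?thesis using p m \<open>0 < q\<close> pm by (intro bounded_ex2I[of m _ 1]) auto
  qed
  show ?thesis
  proof (cases "m \<le> p")
    case True
    show ?thesis by (rule *) fact+
  next
    case False
    then have "m \<le> q" using D m by (simp add: not_le)
      (metis div_less gr0I not_less_eq_eq numeral_2_eq_2 add_0 not_le)
    moreover have "0 < q mod m \<or> 0 < p mod m" using r by metis
    ultimately obtain c d where "c \<le> q" "d \<le> p" "c + d = m + 1" "1 \<le> c div m + d div m"
      "(q - c) div m + (p - d) div m + 1 = q div m + p div m"
      using *[of q p] by blast
    then show ?thesis by (intro bounded_ex2I[of d _ c]) auto
  qed
qed

text \<open>When both exponents are multiples of \<open>m\<close>, the extra factor has to break a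
  second block.\<close>

lemma split_off_two:
  fixes p q m :: nat
  assumes m: "2 \<le> m" and D: "2 \<le> p div m + q div m" and r: "p mod m = 0" "q mod m = 0"
  shows "\<exists>c\<le>p. \<exists>d\<le>q. c + d = m + 1 \<and> 1 \<le> c div m + d div m \<and>
    p div m + q div m \<le> (p - c) div m + (q - d) div m + 2"
proof -
  have m1: "1 \<le> (m + 1) div m" using m by (simp add: less_eq_div_iff_mult_less_eq)
  have *: "\<exists>c\<le>p. \<exists>d\<le>q. c + d = m + 1 \<and> 1 \<le> c div m + d div m \<and>
    p div m + q div m \<le> (p - c) div m + (q - d) div m + 2"
    if D: "2 \<le> p div m + q div m" and r: "p mod m = 0" "q mod m = 0" and p: "m \<le> p" for p q
  \<comment> \<open>The extra unit comes from \<open>q\<close> if possible; for \<open>q = 0\<close>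
    it comes from \<open>p\<close>, which then contains two blocks.\<close>
  proof (cases "q = 0")
    case True
    then have "2 * m \<le> p" using D m by (simp add: less_eq_div_iff_mult_less_eq)
    then have le: "m + 1 \<le> p" "0 < p - m" using m by auto
    have "(p - m) mod m = 0" using p r by (simp add: le_mod_geq)
    then have "(p - m - 1) div m = p div m - 1 - 1"
      using m p pred_div_dvd[of "p - m" m] le diff_div_same[of m p] by simp
    then show ?thesis using le m m1 True by (intro bounded_ex2I[of "m + 1" _ 0]) auto
  next
    case False
    have "(p - m) div m = p div m - 1" "(q - 1) div m = q div m - 1"
      using False r m p pred_div_dvd[of q m] diff_div_same[of m p] by simp_all
    then show ?thesis using p m False by (intro bounded_ex2I[of m _ 1]) auto
  qed
  show ?thesis
  proof (cases "m \<le> p")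
    case True
    show ?thesis by (rule *) fact+
  next
    case False
    then have "m \<le> q" using D m by (cases "m \<le> q") simp_all
    from *[of q p, OF _ _ _ this] r D obtain c d where "c \<le> q" "d \<le> p" "c + d = m + 1" "1 \<le> c div m + d div m"
      "q div m + p div m \<le> (q - c) div m + (p - d) div m + 2" by (auto simp: add.commute)
    then show ?thesis by (intro bounded_ex2I[of d _ c]) auto
  qed
qed

text \<open>
  With \<open>x = x\<^sub>0\<close> and \<open>y = x\<^sub>1\<close>, the set \<open>stair k\<close> below consists of the exponents of
  \<open>((x, y) (x\<^sup>m, y\<^sup>m))\<^sup>k\<close>, and \<open>pow_exps k\<close> of those of the \<open>k\<close>-th power of the ideal generated by
  \<open>(x, y) (x\<^sup>m, y\<^sup>m)\<close> and by \<open>x\<^sub>v (x, y)\<^bsup>2 m - a v\<^esup>\<close> for \<open>v \<ge> 2\<close>. The inequalities are arranged so that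
  no truncated subtraction occurs.
\<close>

locale staircase =
  fixes m n :: nat and a :: "nat \<Rightarrow> nat"
  assumes m_ge_2: "2 \<le> m" and a_le: "v \<in> {2..<n} \<Longrightarrow> 2 * a v \<le> m" and n_ge_2: "2 \<le> n"
begin

definition xy_sum :: "(nat \<Rightarrow>\<^sub>0 nat) \<Rightarrow> nat" where
  "xy_sum t = Poly_Mapping.lookup t 0 + Poly_Mapping.lookup t 1"

text \<open>The largest number of factors \<open>x^m\<close> or \<open>y^m\<close> (blocks) that can
  be split off; each factor from the staircase ideal uses one.\<close>

definition xy_div :: "(nat \<Rightarrow>\<^sub>0 nat) \<Rightarrow> nat" where
  "xy_div t = Poly_Mapping.lookup t 0 div m + Poly_Mapping.lookup t 1 div m"

definition stair :: "nat \<Rightarrow> (nat \<Rightarrow>\<^sub>0 nat) set" where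
  "stair k = {t. k \<le> xy_div t \<and> (m + 1) * k \<le> xy_sum t}"

text \<open>One factor from \<open>x_v (x, y)^(2m - a v)\<close> and \<open>k - 1\<close> factors
  from the staircase ideal give at least \<open>k - 1\<close> blocks and degree at least
  \<open>(m + 1)(k - 1) + 2m - a v\<close> in \<open>x, y\<close>; the inequalities record these
  bounds.\<close>

definition extra :: "nat \<Rightarrow> nat \<Rightarrow> (nat \<Rightarrow>\<^sub>0 nat) set" where
  "extra k v = {t. v \<in> Poly_Mapping.keys t \<and> k \<le> xy_div t + 1 \<and> (m + 1) * k + m \<le> xy_sum t + 1 + a v}"

definition pow_exps :: "nat \<Rightarrow> (nat \<Rightarrow>\<^sub>0 nat) set" where
  "pow_exps k = stair k \<union> (\<Union>v\<in>{2..<n}. extra k v)"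

lemma xy_sum_add: "xy_sum (s + t) = xy_sum s + xy_sum t"
  by (simp add: xy_sum_def lookup_add)

lemma xy_div_add: "xy_div s + xy_div t \<le> xy_div (s + t)"
  unfolding xy_div_def lookup_add
  using div_add_superadditive[of "Poly_Mapping.lookup s 0" m "Poly_Mapping.lookup t 0"]
    div_add_superadditive[of "Poly_Mapping.lookup s 1" m "Poly_Mapping.lookup t 1"] by linarith

text \<open>This is how a large degree in \<open>x, y\<close> forces the existence of
  blocks.\<close>

lemma xy_sum_le: "xy_sum t + 2 \<le> m * xy_div t + 2 * m"
  unfolding xy_sum_def xy_div_def using m_ge_2 by (intro le_mult_div_add) simp

section \<open>Exponent sets of the powers\<close>

lemma pow_exps_up:
  assumes "s \<in> pow_exps k"
  shows "s + t \<in> pow_exps k"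
proof -
  have "xy_div s \<le> xy_div (s + t)" "xy_sum s \<le> xy_sum (s + t)"
    using xy_div_add[of s t] xy_sum_add[of s t] by simp_all
  then have "s \<in> stair k \<Longrightarrow> s + t \<in> stair k" "s \<in> extra k v \<Longrightarrow> s + t \<in> extra k v" for v
    by (auto simp: stair_def extra_def keys_add_nat)
  then show ?thesis using assms unfolding pow_exps_def by blast
qed

lemma pow_exps_0: "pow_exps 0 = UNIV"
  by (simp add: pow_exps_def stair_def)

text \<open>The degree is additive and the number of blocks superadditive, which settles products
  with at most one extra factor.\<close>

lemma pow_exps_add:
  assumes "s \<in> pow_exps k" "t \<in> pow_exps 1"
  shows "s + t \<in> pow_exps (Suc k)"
proof -
  have div: "xy_div s + xy_div t \<le> xy_div (s + t)" and sum: "xy_sum (s + t) = xy_sum s + xy_sum t"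
    by (rule xy_div_add xy_sum_add)+
  consider "s \<in> stair k" "t \<in> stair 1" | v where "s \<in> stair k" "t \<in> extra 1 v" "v \<in> {2..<n}"
    | v where "s \<in> extra k v" "t \<in> stair 1" "v \<in> {2..<n}"
    | u v where "s \<in> extra k u" "u \<in> {2..<n}" "t \<in> extra 1 v" "v \<in> {2..<n}"
    using assms unfolding pow_exps_def by blast
  then show ?thesis
  proof cases
    case 1
    then have "s + t \<in> stair (Suc k)" using div sum by (simp add: stair_def)
    then show ?thesis by (simp add: pow_exps_def)
  next
    case 2
    then have "s + t \<in> extra (Suc k) v" using div sum by (simp add: stair_def extra_def keys_add_nat)
    then show ?thesis using 2 unfolding pow_exps_def by blast
  next
    case 3
    then have "s + t \<in> extra (Suc k) v" using div sum by (simp add: stair_def extra_def keys_add_nat)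
    then show ?thesis using 3 unfolding pow_exps_def by blast
  next
    case 4
    \<comment> \<open>With two extra factors the degree is at least
      \<open>(m + 1) * k + 2 * m - 1\<close>, because \<open>a u\<close> and \<open>a v\<close> are
      at most half of \<open>m\<close>. By \<open>xy_sum_le\<close> this forces \<open>k + 1\<close>
      blocks, so the product lies in the staircase itself.\<close>
    have "2 * a u \<le> m" "2 * a v \<le> m" using 4 a_le by auto
    then have ge: "(m + 1) * k + 2 * m \<le> xy_sum (s + t) + 1"
      using 4 sum by (simp add: extra_def)
    have "m * k + k + 1 \<le> m * xy_div (s + t)" using ge xy_sum_le[of "s + t"] by simp
    then have "m * k < m * xy_div (s + t)" by linarith
    then have "Suc k \<le> xy_div (s + t)" by simp
    moreover have "(m + 1) * Suc k \<le> xy_sum (s + t)" using ge m_ge_2 by simp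
    ultimately show ?thesis by (simp add: pow_exps_def stair_def)
  qed
qed

text \<open>For \<open>k \<ge> 1\<close> a generator in \<open>x, y\<close> alone can always be
  split off; an extra variable stays with the other factor.\<close>

lemma pow_exps_split:
  assumes r: "r \<in> pow_exps (Suc k)" "r \<in> exps n"
  shows "\<exists>s t. s \<in> pow_exps k \<and> t \<in> pow_exps 1 \<and> s \<in> exps n \<and> t \<in> exps n \<and> r = s + t"
proof (cases k)
  case 0
  then show ?thesis using r by (intro exI[of _ 0] exI[of _ r]) (auto simp: pow_exps_0)
next
  case (Suc k')
  let ?p = "Poly_Mapping.lookup r 0" and ?q = "Poly_Mapping.lookup r 1"
  \<comment> \<open>\<open>s\<close> is described by its exponents at \<open>x, y\<close> and by
    which other variables occur, which is all that membership in \<open>pow_exps k\<close> depends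
    on.\<close>
  have *: ?thesis if "c \<le> ?p" "d \<le> ?q" "c + d = m + 1" "1 \<le> c div m + d div m"
    and s: "\<And>s. Poly_Mapping.lookup s 0 = ?p - c \<Longrightarrow> Poly_Mapping.lookup s 1 = ?q - d \<Longrightarrow>
      Poly_Mapping.keys s \<inter> {2..} = Poly_Mapping.keys r \<inter> {2..} \<Longrightarrow> s \<in> pow_exps k" for c d
  proof -
    let ?t = "Poly_Mapping.single 0 c + Poly_Mapping.single (1::nat) d"
    have 1: "?t \<in> pow_exps 1"
      using that by (simp add: pow_exps_def stair_def xy_div_def xy_sum_def lookup_add lookup_single)
    have 2: "?t \<in> exps n" using n_ge_2 by (auto simp: keys_add_nat)
    have lk: "Poly_Mapping.lookup (r - ?t) i = (if i = 0 then ?p - c else if i = 1 then ?q - d else Poly_Mapping.lookup r i)" for i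
      by (simp add: lookup_minus lookup_add lookup_single when_def)
    have 3: "r - ?t \<in> pow_exps k"
      by (rule s) (auto simp: lk in_keys_iff simp del: One_nat_def)
    have 4: "r - ?t \<in> exps n" using r(2) by (auto simp: in_keys_iff lk subset_iff simp del: One_nat_def split: if_splits)
    have 5: "r = (r - ?t) + ?t"
      using that by (intro poly_mapping_eqI) (simp add: lk lookup_add lookup_single when_def del: One_nat_def)
    show ?thesis using 1 2 3 4 5 by blast
  qed
  have stair_case: ?thesis if rs: "Suc k \<le> xy_div r" "(m + 1) * Suc k \<le> xy_sum r"
  proof (cases "0 < ?p mod m \<or> 0 < ?q mod m")
    case True
    have "1 \<le> ?p div m + ?q div m" using rs(1) by (simp add: xy_div_def)
    from split_off_one[OF m_ge_2 this True] obtain c d where cd: "c \<le> ?p" "d \<le> ?q" "c + d = m + 1"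
      "1 \<le> c div m + d div m" "(?p - c) div m + (?q - d) div m + 1 = xy_div r"
      unfolding xy_div_def by blast
    show ?thesis
    proof (rule *[OF cd(1-4)])
      fix s :: "nat \<Rightarrow>\<^sub>0 nat" assume "Poly_Mapping.lookup s 0 = ?p - c" "Poly_Mapping.lookup s 1 = ?q - d"
      then have "s \<in> stair k" using cd rs by (simp add: stair_def xy_div_def xy_sum_def)
      then show "s \<in> pow_exps k" by (simp add: pow_exps_def)
    qed
  next
    case False
    \<comment> \<open>Now the degree is \<open>m\<close> times the number of blocks, so the bound
      \<open>(m + 1) * Suc k\<close> forces a spare block and two may be lost.\<close>
    then have "?p = m * (?p div m)" "?q = m * (?q div m)" by auto
    then have "xy_sum r = m * xy_div r" unfolding xy_sum_def xy_div_def by (metis distrib_left)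
    then have "m * Suc k < m * xy_div r" using rs by simp
    then have "Suc k < xy_div r" by (simp only: mult_less_cancel1)
    then have D: "k + 2 \<le> xy_div r" by simp
    have "2 \<le> ?p div m + ?q div m" "?p mod m = 0" "?q mod m = 0"
      using D False by (simp_all add: xy_div_def)
    from split_off_two[OF m_ge_2 this] obtain c d where cd: "c \<le> ?p" "d \<le> ?q" "c + d = m + 1"
      "1 \<le> c div m + d div m" "xy_div r \<le> (?p - c) div m + (?q - d) div m + 2"
      unfolding xy_div_def by blast
    show ?thesis
    proof (rule *[OF cd(1-4)])
      fix s :: "nat \<Rightarrow>\<^sub>0 nat" assume "Poly_Mapping.lookup s 0 = ?p - c" "Poly_Mapping.lookup s 1 = ?q - d"
      then have "s \<in> stair k" using cd rs D by (simp add: stair_def xy_div_def xy_sum_def)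
      then show "s \<in> pow_exps k" by (simp add: pow_exps_def)
    qed
  qed
  show ?thesis
  proof (cases "r \<in> stair (Suc k)")
    case True
    then show ?thesis by (intro stair_case) (simp_all add: stair_def)
  next
    case False
    then obtain v where v: "v \<in> {2..<n}" "r \<in> extra (Suc k) v" using r by (auto simp: pow_exps_def)
    have av: "2 * a v \<le> m" using v a_le by auto
    have ex: "k \<le> xy_div r" "(m + 1) * Suc k + m \<le> xy_sum r + 1 + a v" "v \<in> Poly_Mapping.keys r"
      using v by (simp_all add: extra_def)
    have ge: "(m + 1) * Suc k \<le> xy_sum r" using ex av m_ge_2 by simp
    show ?thesis
    proof (cases "Suc k \<le> xy_div r")
      case True
      then show ?thesis using ge by (rule stair_case)
    next
      case False
      \<comment> \<open>With exactly \<open>k\<close> blocks the degree exceeds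
        \<open>m * k\<close>, so some remainder is positive and only one block is lost. Here
        \<open>k \<ge> 1\<close> ensures that there is a block to split off.\<close>
      then have D: "xy_div r = k" using ex by simp
      have "0 < ?p mod m \<or> 0 < ?q mod m"
      proof (rule ccontr)
        assume "\<not> ?thesis"
        then have "?p = m * (?p div m)" "?q = m * (?q div m)" by auto
        then have "xy_sum r = m * xy_div r" unfolding xy_sum_def xy_div_def by (metis distrib_left)
        then show False using ge D by simp
      qed
      moreover have "1 \<le> ?p div m + ?q div m" using D Suc by (simp add: xy_div_def)
      ultimately obtain c d where cd: "c \<le> ?p" "d \<le> ?q" "c + d = m + 1"
        "1 \<le> c div m + d div m" "(?p - c) div m + (?q - d) div m + 1 = xy_div r"
        unfolding xy_div_def using split_off_one[OF m_ge_2] by blast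
      show ?thesis
      proof (rule *[OF cd(1-4)])
        fix s :: "nat \<Rightarrow>\<^sub>0 nat" assume s: "Poly_Mapping.lookup s 0 = ?p - c" "Poly_Mapping.lookup s 1 = ?q - d"
          "Poly_Mapping.keys s \<inter> {2..} = Poly_Mapping.keys r \<inter> {2..}"
        have "v \<in> Poly_Mapping.keys s" using s(3) v(1) ex(3) by auto
        moreover have "k \<le> xy_div s + 1" using s cd D by (simp add: xy_div_def)
        moreover have "xy_sum s + (m + 1) = xy_sum r" using s cd by (simp add: xy_sum_def)
        ultimately have "s \<in> extra k v" using ex by (simp add: extra_def)
        then show "s \<in> pow_exps k" using v by (auto simp: pow_exps_def)
      qed
    qed
  qed
qed

text \<open>For \<open>a v \<le> k\<close> an exponent in \<open>extra k v\<close> has degree at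
  least \<open>m * k + m - 1\<close> in \<open>x, y\<close>, which by \<open>xy_sum_le\<close>
  requires \<open>k\<close> blocks. So it lies in \<open>stair k\<close>, whose conditions concern
  \<open>x\<close> and \<open>y\<close> only.\<close>

lemma pow_exps_free:
  assumes t: "Poly_Mapping.single v 1 + t \<in> pow_exps k" and v: "v \<in> {2..<n}" "a v \<le> k"
  shows "t \<in> pow_exps k"
proof -
  let ?t = "Poly_Mapping.single v 1 + t"
  have eq: "xy_div ?t = xy_div t" "xy_sum ?t = xy_sum t"
    using v by (simp_all add: xy_div_def xy_sum_def lookup_add lookup_single when_def)
  have av: "2 * a v \<le> m" using v a_le by auto
  consider "?t \<in> stair k" | u where "u \<in> {2..<n}" "?t \<in> extra k u" "u \<noteq> v" | "?t \<in> extra k v"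
    using t unfolding pow_exps_def by blast
  then show ?thesis
  proof cases
    case 1
    then have "t \<in> stair k" by (simp add: stair_def eq del: One_nat_def)
    then show ?thesis by (simp add: pow_exps_def)
  next
    case 2
    then have "t \<in> extra k u" by (simp add: extra_def eq keys_add_nat del: One_nat_def)
    then show ?thesis using 2 by (auto simp: pow_exps_def)
  next
    case 3
    then have ex: "(m + 1) * k + m \<le> xy_sum t + 1 + a v" by (simp add: extra_def eq del: One_nat_def)
    have "m * k + 1 \<le> m * xy_div t + m"
      using ex v(2) xy_sum_le[of t] by simp
    then have "m * k < m * Suc (xy_div t)" by simp
    then have "k \<le> xy_div t" by (simp only: mult_less_cancel1) simp
    moreover have "(m + 1) * k \<le> xy_sum t" using ex av m_ge_2 by simp
    ultimately show ?thesis by (simp add: pow_exps_def stair_def)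
  qed
qed

text \<open>For \<open>k < m\<close> the witness is \<open>x^(m k - 1) y^(m - 1)\<close>, of maximal
  degree among monomials in \<open>x, y\<close> with \<open>k - 1\<close> blocks. Multiplying by
  \<open>x\<close> or \<open>y\<close> completes a block; multiplying by \<open>x_v\<close> leads
  into \<open>extra k v\<close> exactly when \<open>k < a v\<close>. For \<open>k \<ge> m\<close> no
  \<open>a v\<close> exceeds \<open>k\<close>, and a power of \<open>x\<close> one short of the
  degree bound works.\<close>

lemma pow_exps_socle:
  assumes k: "1 \<le> k"
  shows "\<exists>w. Poly_Mapping.keys w \<subseteq> {0, 1} \<and> w \<notin> pow_exps k \<and>
    (\<forall>v<n. (2 \<le> v \<longrightarrow> k < a v) \<longrightarrow> Poly_Mapping.single v 1 + w \<in> pow_exps k)"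
proof (cases "k < m")
  case True
  let ?w = "Poly_Mapping.single 0 (m * k - 1) + Poly_Mapping.single (1::nat) (m - 1)"
  have lk: "Poly_Mapping.lookup ?w 0 = m * k - 1" "Poly_Mapping.lookup ?w 1 = m - 1"
    by (simp_all add: lookup_add lookup_single)
  have mk: "1 \<le> m * k" using k m_ge_2 by simp
  have div: "(m * k - 1) div m = k - 1" "(m - 1) div m = 0"
    using pred_div_dvd[of "m * k" m] mk m_ge_2 by simp_all
  have D: "xy_div ?w = k - 1" "xy_sum ?w + 2 = m * k + m"
    unfolding xy_div_def xy_sum_def lk div using m_ge_2 mk by simp_all
  have keys: "Poly_Mapping.keys ?w \<subseteq> {0, 1}" by (auto simp: keys_add_nat)
  show ?thesis
  proof (intro exI[of _ ?w] conjI allI impI)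
    show "Poly_Mapping.keys ?w \<subseteq> {0, 1}" by (rule keys)
    show "?w \<notin> pow_exps k" using keys D k by (auto simp: pow_exps_def stair_def extra_def)
    fix v assume v: "v < n" "2 \<le> v \<longrightarrow> k < a v"
    show "Poly_Mapping.single v 1 + ?w \<in> pow_exps k"
    proof (cases "2 \<le> v")
      case True
      let ?s = "Poly_Mapping.single v 1 + ?w"
      have "xy_div ?s = xy_div ?w" "xy_sum ?s = xy_sum ?w"
        using True by (simp_all add: xy_div_def xy_sum_def lookup_add lookup_single when_def)
      then have "?s \<in> extra k v" using D v True k by (simp add: extra_def keys_add_nat)
      then show ?thesis using v True by (auto simp: pow_exps_def)
    next
      case False
      then have "v = 0 \<or> v = 1" by auto
      then have "xy_div (Poly_Mapping.single v 1 + ?w) = k"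
        "xy_sum (Poly_Mapping.single v 1 + ?w) = xy_sum ?w + 1"
        using div mk k m_ge_2 by (auto simp: xy_div_def xy_sum_def lookup_add lookup_single)
      \<comment> \<open>The degree is now \<open>m * k + m - 1\<close>, which reaches
        \<open>(m + 1) * k\<close> because \<open>k < m\<close>.\<close>
      then show ?thesis using D \<open>k < m\<close> m_ge_2 by (simp add: pow_exps_def stair_def)
    qed
  qed
next
  case False
  let ?w = "Poly_Mapping.single (0::nat) ((m + 1) * k - 1)"
  show ?thesis
  proof (intro exI[of _ ?w] conjI allI impI)
    show "Poly_Mapping.keys ?w \<subseteq> {0, 1}" by auto
    have "xy_sum ?w < (m + 1) * k" using k by (simp add: xy_sum_def lookup_single)
    then show "?w \<notin> pow_exps k" by (auto simp: pow_exps_def stair_def extra_def)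
    fix v assume v: "v < n" "2 \<le> v \<longrightarrow> k < a v"
    have "v = 0 \<or> v = 1" using a_le[of v] v False by force
    moreover have "k \<le> ((m + 1) * k - 1) div m" "k \<le> Suc ((m + 1) * k - 1) div m"
      using k m_ge_2 by (simp_all add: less_eq_div_iff_mult_less_eq algebra_simps)
    ultimately show "Poly_Mapping.single v 1 + ?w \<in> pow_exps k"
      using k by (auto simp: pow_exps_def stair_def xy_div_def xy_sum_def lookup_add lookup_single)
  qed
qed

section \<open>Powers of the ideal and their depth\<close>

lemma nat_pow_monom_span:
  "(monom_span n (pow_exps 1) :: ((nat \<Rightarrow>\<^sub>0 nat) \<Rightarrow>\<^sub>0 'k::field) set) [^]\<^bsub>ideals_set (mpoly_ring n)\<^esub> k
    = monom_span n (pow_exps k)"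
proof (induction k)
  case 0
  then show ?case by (simp add: nat_pow_def ideals_set_def pow_exps_0 carrier_eq_monom_span)
next
  case (Suc k)
  have "monom_span n (pow_exps k) \<cdot>\<^bsub>mpoly_ring n\<^esub> monom_span n (pow_exps 1)
    = (monom_span n (pow_exps (Suc k)) :: ((nat \<Rightarrow>\<^sub>0 nat) \<Rightarrow>\<^sub>0 'k) set)"
  proof (rule ideal_prod_monom_span)
    fix r assume "r \<in> exps n"
    then show "r \<in> pow_exps (Suc k) \<longleftrightarrow>
      (\<exists>s t. s \<in> pow_exps k \<and> t \<in> pow_exps 1 \<and> s \<in> exps n \<and> t \<in> exps n \<and> r = s + t)"
      using pow_exps_split[of r k] pow_exps_add by blast
  qed (rule pow_exps_up, assumption)+
  then show ?case using Suc by (simp add: nat_pow_def ideals_set_def)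
qed

text \<open>All monomials of the span serve as generators.\<close>

lemma monomial_ideal_monom_span: "monomial_ideal n (monom_span n (pow_exps k))"
proof -
  have "Idl\<^bsub>mpoly_ring n\<^esub> (monomial ` (pow_exps k \<inter> exps n))
    = monom_span n {s + t | s t. s \<in> pow_exps k \<inter> exps n \<and> t \<in> exps n}"
    by (rule genideal_monomials) auto
  also have "\<dots> = monom_span n (pow_exps k)"
  proof (rule monom_span_cong)
    fix r assume r: "r \<in> exps n"
    have "r = r + 0" "0 \<in> exps n" by simp_all
    then show "r \<in> {s + t | s t. s \<in> pow_exps k \<inter> exps n \<and> t \<in> exps n} \<longleftrightarrow> r \<in> pow_exps k"
      using r pow_exps_up by blast
  qed
  finally have eq: "Idl\<^bsub>mpoly_ring n\<^esub> (monomial ` (pow_exps k \<inter> exps n)) = monom_span n (pow_exps k)" .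
  show ?thesis
    unfolding monomial_ideal_def
    by (intro exI[of _ "pow_exps k \<inter> exps n"] conjI) (rule Int_lower2, rule eq[symmetric])
qed

text \<open>The sequence consists of the \<open>d\<close> variables \<open>2, ..., d + 1\<close>,
  the extra ones with \<open>a v \<le> k\<close>. \<open>pow_exps_free\<close> makes it regular, and
  \<open>pow_exps_socle\<close> provides the element killed by all other variables.\<close>

lemma depth_pow:
  assumes k: "1 \<le> k" and d: "d + 2 \<le> n" and a: "\<And>v. v \<in> {2..<n} \<Longrightarrow> a v \<le> k \<longleftrightarrow> v < d + 2"
  shows "depth (mpoly_ring n) (graded_max_ideal n)
    (quot_module (mpoly_ring n) (monom_span n (pow_exps k) :: ((nat \<Rightarrow>\<^sub>0 nat) \<Rightarrow>\<^sub>0 'k::field) set)) = enat d"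
proof -
  let ?I = "monom_span n (pow_exps k) :: ((nat \<Rightarrow>\<^sub>0 nat) \<Rightarrow>\<^sub>0 'k) set"
  define vs where "vs = [2..<d + 2]"
  have set_vs: "set vs = {2..<d + 2}" and "distinct vs" and len: "length vs = d"
    and nth: "i < d \<Longrightarrow> vs ! i = i + 2" for i
    unfolding vs_def using nth_upt[of 2 i "d + 2"] by auto
  have vs: "set vs \<subseteq> {..<n}" using d by (auto simp: set_vs)
  define E where "E i = pow_exps k \<union> {t. \<exists>j<i. vs ! j \<in> Poly_Mapping.keys t}" for i
  have seq: "seq_ideal n ?I (map var vs) i = monom_span n (E i)" if "i \<le> length vs" for i
    unfolding E_def by (rule seq_ideal_vars[OF _ vs that]) (rule pow_exps_up)
  have "0 \<notin> pow_exps k" using k by (auto simp: pow_exps_def stair_def extra_def xy_div_def)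
  then have proper: "?I \<subseteq> graded_max_ideal n"
    unfolding graded_max_ideal_eq by (auto simp: monom_span_def)
  obtain w where w: "Poly_Mapping.keys w \<subseteq> {0, 1}" "w \<notin> pow_exps k"
    "\<And>v. v < n \<Longrightarrow> (2 \<le> v \<Longrightarrow> k < a v) \<Longrightarrow> Poly_Mapping.single v 1 + w \<in> pow_exps k"
    using pow_exps_socle[OF k] by blast
  have w_exps: "w \<in> exps n" using w(1) n_ge_2 by auto
  have "depth (mpoly_ring n) (graded_max_ideal n) (quot_module (mpoly_ring n) ?I) = enat (length vs)"
  proof (rule depth_quot_module_eqI[where w = "monomial w"])
    show "ideal ?I (mpoly_ring n)" by (intro ideal_monom_span pow_exps_up)
    show "?I \<subseteq> graded_max_ideal n" by (rule proper)
    show "set vs \<subseteq> {..<n}" "distinct vs" by fact+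
    show "monomial w \<in> carrier (mpoly_ring n)" using w_exps by (simp add: monomial_def in_carrier_mpoly_ring_iff)
    show "monomial w \<notin> seq_ideal n ?I (map var vs) (length vs)"
    proof -
      \<comment> \<open>\<open>w\<close> involves only the indices \<open>0\<close> and
        \<open>1\<close>, while \<open>vs\<close> starts at \<open>2\<close>.\<close>
      have "w \<notin> E d" using w(1,2) by (auto simp: E_def nth)
      then show ?thesis using seq[of d] by (simp add: len monom_span_def monomial_def)
    qed
    show "var v * monomial w \<in> ?I" if "v < n" "v \<notin> set vs" for v
    proof -
      have "k < a v" if "2 \<le> v" using a[of v] \<open>2 \<le> v\<close> \<open>v < n\<close> \<open>v \<notin> set vs\<close> by (simp add: set_vs)
      then have "Poly_Mapping.single v 1 + w \<in> pow_exps k" using that by (intro w(3))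
      moreover have "Poly_Mapping.single v 1 + w \<in> exps n" using w_exps that by (intro exps_add) auto
      ultimately have "Poly_Mapping.single (Poly_Mapping.single v 1 + w) 1 \<in> ?I" by (rule single_in_monom_span)
      then show ?thesis by (simp add: monomial_def mult_single)
    qed
    fix i y assume i: "i < length vs" and y: "y \<in> carrier (mpoly_ring n)"
      "var (vs ! i) * y \<in> seq_ideal n ?I (map var vs) i"
    have v: "vs ! i = i + 2" using i by (simp add: nth len)
    show "y \<in> seq_ideal n ?I (map var vs) i"
      unfolding seq[OF less_imp_le[OF i]]
    proof (rule monom_span_cancel_monomial[OF _ y(1)])
      show "var (vs ! i) * y \<in> monom_span n (E i)"
        using y(2) unfolding seq[OF less_imp_le[OF i]] .
      fix t assume "t \<in> exps n" and t: "Poly_Mapping.single (vs ! i) 1 + t \<in> E i"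
      show "t \<in> E i"
      proof (cases "Poly_Mapping.single (vs ! i) 1 + t \<in> pow_exps k")
        case True
        have "t \<in> pow_exps k"
          by (rule pow_exps_free[OF True]) (use i v d a[of "i + 2"] in \<open>simp_all add: len\<close>)
        then show ?thesis by (simp add: E_def)
      next
        \<comment> \<open>Divisibility by an earlier variable passes to \<open>t\<close>, because
          that variable differs from \<open>vs ! i\<close>.\<close>
        case False
        then obtain j where j: "j < i" "vs ! j \<in> Poly_Mapping.keys (Poly_Mapping.single (vs ! i) 1 + t)"
          using t by (auto simp: E_def)
        moreover have "vs ! j \<noteq> vs ! i" using j(1) i by (simp add: nth len)
        ultimately have "vs ! j \<in> Poly_Mapping.keys t" by (simp add: keys_add_nat)
        then show ?thesis using j(1) by (auto simp: E_def)
      qed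
    qed
  qed
  then show ?thesis by (simp add: len)
qed

end

section \<open>Realisation of a given function\<close>

theorem theorem4p1:
  fixes f :: "nat \<Rightarrow> nat"
  assumes "mono_on {1..} f" and "bdd_above (f ` {1..})"
  shows "\<exists>n. \<exists>I :: ((nat \<Rightarrow>\<^sub>0 nat) \<Rightarrow>\<^sub>0 'k::field) set.
           monomial_ideal n I \<and>
           (\<forall>k\<ge>1. depth (mpoly_ring n) (graded_max_ideal n)
                     (quot_module (mpoly_ring n) (I [^]\<^bsub>ideals_set (mpoly_ring n)\<^esub> k))
                   = enat (f k))"
proof -
  have mono: "f j \<le> f k" if "1 \<le> j" "j \<le> k" for j k
    using assms(1) that by (auto simp: mono_on_def)
  have "finite (f ` {1..})" using assms(2) by (simp add: bdd_above_nat)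
  then have "Max (f ` {1..}) \<in> f ` {1..}" by (intro Max_in) auto
  then obtain K where K: "1 \<le> K" "f K = Max (f ` {1..})" by auto
  have le_K: "f k \<le> f K" if "1 \<le> k" for k
    using K(2) \<open>finite (f ` {1..})\<close> that by simp
  \<comment> \<open>Variables \<open>0\<close> and \<open>1\<close> are \<open>x\<close> and
    \<open>y\<close>; the maximum \<open>f K\<close> of \<open>f\<close> is the number of extra
    variables.\<close>
  define n where "n = f K + 2"
  define a where "a v = (LEAST k. 1 \<le> k \<and> v < f k + 2)" for v
  have a_le_K: "a v \<le> K" if "v < n" for v
    unfolding a_def using that K by (intro Least_le) (simp add: n_def)
  have a_iff: "a v \<le> k \<longleftrightarrow> v < f k + 2" if "v < n" "1 \<le> k" for v k
  proof
    \<comment> \<open>\<open>K\<close> shows that the minimum is taken over a nonempty set, as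
      \<open>v < f K + 2\<close>; monotonicity then carries the bound from \<open>a v\<close> to
      \<open>k\<close>.\<close>
    have "1 \<le> a v \<and> v < f (a v) + 2"
      unfolding a_def by (rule LeastI[of _ K]) (use that K in \<open>simp add: n_def\<close>)
    moreover assume "a v \<le> k"
    ultimately show "v < f k + 2" using mono[of "a v" k] by simp
  next
    assume "v < f k + 2"
    then show "a v \<le> k" unfolding a_def using that by (intro Least_le) simp
  qed
  \<comment> \<open>\<open>m = 2 * K\<close> is large enough: \<open>a v \<le> K\<close> gives
    \<open>2 * a v \<le> m\<close>, and \<open>K \<ge> 1\<close> gives
    \<open>m \<ge> 2\<close>.\<close>
  interpret staircase "2 * K" n a
  proof
    show "2 \<le> 2 * K" "2 \<le> n" using K by (simp_all add: n_def)
    show "2 * a v \<le> 2 * K" if "v \<in> {2..<n}" for v using a_le_K[of v] that by simp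
  qed
  have "depth (mpoly_ring n) (graded_max_ideal n) (quot_module (mpoly_ring n)
      ((monom_span n (pow_exps 1) :: ((nat \<Rightarrow>\<^sub>0 nat) \<Rightarrow>\<^sub>0 'k) set) [^]\<^bsub>ideals_set (mpoly_ring n)\<^esub> k)) = enat (f k)"
    if "1 \<le> k" for k
    unfolding nat_pow_monom_span
    using that le_K[of k] a_iff by (intro depth_pow) (auto simp: n_def)
  then show ?thesis using monomial_ideal_monom_span[of 1] by blast
qed

end
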